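(* Let $u^*$ be a solution to the stochastic program $\min_{u\in U}\{f(u)=\mathbb{E}[J(u,\xi)]+\Psi(u)\}$, let $N\in\mathbb{N}$ ($N\ge 1$), and let $u_N^*:\Omega\to U$ be a solution to the sample average approximation (SAA) problem $\min_{u\in U}\{f_N(u)=\frac1N\sum_{i=1}^N J(u,\xi^i)+\Psi(u)\}$ (that is, for each $\omega\in\Omega$, $u_N^*(\omega)$ minimizes $f_N(\cdot,\omega)$ over $U$). Assume: (a) $U$ is a real, separable Hilbert space; (b) $\Psi:U\to\mathbb{R}\cup\{\infty\}$ is convex, proper, and lower-semicontinuous; (c) $J:U\times\Xi\to\mathbb{R}$ is a Carathéodory function and, for some $\alpha>0$, $J(\cdot,\xi)$ is $\alpha$-strongly convex for each $\xi\in\Xi$; (d) $J(\cdot,\xi)$ is Gâteaux differentiable on a convex neighborhood of $\mathrm{dom}\,\Psi$ for all $\xi\in\Xi$, and $\nabla_u J(u^*,\cdot):\Xi\to U$ is measurable; (e) $F:U\to\mathbb{R}\cup\{\infty\}$, $F(u)=\mathbb{E}[J(u,\xi)]$, is Gâteaux differentiable at $u^*$; (f) for some $\sigma>0$, $\mathbb{E}\big[\|\nabla_u J(u^*,\xi)-\nabla F(u^* )\|_U^2\big]\le\sigma^2$. Then $$\mathbb{E}\big[\|u^*-u_N^*\|_U^2\big]\le \frac{\sigma^2}{\alpha^2N}.$$ If in addition, for some $\tau>0$, $\mathbb{E}\big[\exp\big(\tau^{-2}\|\nabla_u J(u^*,\xi)-\nabla F(u^* )\|_U^2\big)\big]\le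 \mathrm{e}$, then for all $\varepsilon>0$, $$\mathrm{Prob}\big(\|u^*-u_N^*\|_U\ge\varepsilon\big)\le 2\exp\big(-\tau^{-2}N\varepsilon^2\alpha^2/3\big).$$
   Context: Setting. $\Xi$ is a complete, separable metric space with its Borel $\sigma$-field; $\xi$ is a random element with values in $\Xi$ (the symbol $\xi$ also denotes a deterministic element of $\Xi$). $\xi^1,\xi^2,\ldots$ are independent identically distributed $\Xi$-valued random elements defined on a complete probability space $(\Omega,\mathcal{F},P)$, each with the same distribution as $\xi$; $f_N$ is viewed as a function on $U\times\Omega$. Solutions to both problems are assumed to exist; a solution to $\min_{u\in U} f(u)$ is a minimizer of $f$ with finite objective value. The function $F(u)=\mathbb{E}[J(u,\xi)]$ is taken to be well-defined with values in $\mathbb{R}\cup\{\infty\}$. Definitions. $\mathrm{dom}\,\Psi=\{u\in U:\Psi(u)<\infty\}$. A function $\mathsf{f}:U\to\mathbb{R}\cup\{\infty\}$ is $\alpha$-strongly convex ($\alpha>0$) if $\mathsf{f}(\cdot)-(\alpha/2)\|\cdot\|_U^2$ is convex. $J$ is a Carathéodory function if $J(\cdot,\xi)$ is continuous for every $\xi\in\Xi$ and $J(u,\cdot)$ is (Borel) measurable for every $u\in U$. Gradients $\nabla F(u^* )$, $\nabla_u J(u,\xi)$ (derivative with respect to the first argument) are the elements of $U$ that represent the (bounded, linear) Gâteaux derivatives via the inner product of $U$. $\mathrm{e}=\exp(1)$. *)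

theory Defs
  imports "HOL-Probability.Probability"
begin

definition eff_dom :: "('u \<Rightarrow> ereal) \<Rightarrow> 'u set" where
  "eff_dom \<Psi> = {u. \<Psi> u < \<infinity>}"

text \<open>Since \<^prop>\<open>0 * (\<infinity>::ereal) = 0\<close>, the end points of the segment need no special
  treatment. The predicate is meant for functions that never take the value \<^term>\<open>- \<infinity>\<close>.\<close>

definition ext_convex :: "('u :: real_vector \<Rightarrow> ereal) \<Rightarrow> bool" where
  "ext_convex \<Psi> \<longleftrightarrow>
     (\<forall>u v. \<forall>t\<in>{0..1}. \<Psi> ((1 - t) *\<^sub>R u + t *\<^sub>R v) \<le> ereal (1 - t) * \<Psi> u + ereal t * \<Psi> v)"

definition proper :: "('u \<Rightarrow> ereal) \<Rightarrow> bool" where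
  "proper \<Psi> \<longleftrightarrow> (\<forall>u. \<Psi> u \<noteq> - \<infinity>) \<and> eff_dom \<Psi> \<noteq> {}"

definition lower_semicontinuous :: "('u :: topological_space \<Rightarrow> ereal) \<Rightarrow> bool" where
  "lower_semicontinuous \<Psi> \<longleftrightarrow> (\<forall>u. \<Psi> u \<le> Liminf (at u) \<Psi>)"

definition strongly_convex :: "real \<Rightarrow> ('u :: real_normed_vector \<Rightarrow> real) \<Rightarrow> bool" where
  "strongly_convex \<alpha> g \<longleftrightarrow> convex_on UNIV (\<lambda>u. g u - \<alpha> / 2 * (norm u)\<^sup>2)"

definition solution :: "('u \<Rightarrow> ereal) \<Rightarrow> 'u \<Rightarrow> bool" where
  "solution f u \<longleftrightarrow> (\<forall>v. f u \<le> f v) \<and> \<bar>f u\<bar> \<noteq> \<infinity>"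

text \<open>The difference quotients are formed in \<^typ>\<open>ereal\<close>, so that convergence to a real number
  forces \<open>f\<close> to be finite at \<open>u + t h\<close> for all small \<open>t\<close> (depending on the direction \<open>h\<close>).
  A real-valued function is coerced to \<^typ>\<open>ereal\<close>.\<close>

definition has_gateaux_derivative ::
    "('u :: real_normed_vector \<Rightarrow> ereal) \<Rightarrow> ('u \<Rightarrow> real) \<Rightarrow> 'u \<Rightarrow> bool" where
  "has_gateaux_derivative f D u \<longleftrightarrow>
     \<bar>f u\<bar> \<noteq> \<infinity> \<and> bounded_linear D \<and>
     (\<forall>h. ((\<lambda>t. (f (u + t *\<^sub>R h) - f u) / ereal t) \<longlongrightarrow> ereal (D h)) (at 0))"

definition gateaux_differentiable :: "('u :: real_normed_vector \<Rightarrow> ereal) \<Rightarrow> 'u \<Rightarrow> bool" where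
  "gateaux_differentiable f u \<longleftrightarrow> (\<exists>D. has_gateaux_derivative f D u)"

definition gradient :: "('u :: real_inner \<Rightarrow> ereal) \<Rightarrow> 'u \<Rightarrow> 'u" where
  "gradient f u = (THE g. has_gateaux_derivative f (\<lambda>h. g \<bullet> h) u)"

definition partial_gradient ::
    "('u :: real_inner \<Rightarrow> 'x \<Rightarrow> real) \<Rightarrow> 'u \<Rightarrow> 'x \<Rightarrow> 'u" where
  "partial_gradient J u x = gradient (\<lambda>v. ereal (J v x)) u"

definition caratheodory ::
    "('u :: topological_space \<Rightarrow> 'x :: topological_space \<Rightarrow> real) \<Rightarrow> bool" where
  "caratheodory J \<longleftrightarrow>
     (\<forall>x. continuous_on UNIV (\<lambda>u. J u x)) \<and> (\<forall>u. (\<lambda>x. J u x) \<in> borel_measurable borel)"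

text \<open>Expectation of a real random variable with values in the reals together with \<^term>\<open>\<infinity>\<close>:
  it is well-defined iff the negative part is integrable, and is then the difference of the
  integrals of the positive and the negative part (\<^const>\<open>ennreal\<close> maps negative reals to 0).\<close>

definition expectation_defined :: "'a measure \<Rightarrow> ('a \<Rightarrow> real) \<Rightarrow> bool" where
  "expectation_defined A X \<longleftrightarrow> X \<in> borel_measurable A \<and> (\<integral>\<^sup>+ a. ennreal (- X a) \<partial>A) < \<infinity>"

definition ext_expectation :: "'a measure \<Rightarrow> ('a \<Rightarrow> real) \<Rightarrow> ereal" where
  "ext_expectation A X =
     enn2ereal (\<integral>\<^sup>+ a. ennreal (X a) \<partial>A) - enn2ereal (\<integral>\<^sup>+ a. ennreal (- X a) \<partial>A)"

definition expected_cost :: "'a measure \<Rightarrow> ('a \<Rightarrow> 'x) \<Rightarrow> ('u \<Rightarrow> 'x \<Rightarrow> real) \<Rightarrow> 'u \<Rightarrow> ereal" where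
  "expected_cost A \<xi> J u = ext_expectation A (\<lambda>a. J u (\<xi> a))"

definition sample_average ::
    "nat \<Rightarrow> (nat \<Rightarrow> 'w \<Rightarrow> 'x) \<Rightarrow> ('u \<Rightarrow> 'x \<Rightarrow> real) \<Rightarrow> 'u \<Rightarrow> 'w \<Rightarrow> real" where
  "sample_average N \<xi>s J u \<omega> = (1 / real N) * (\<Sum>i = 1..N. J u (\<xi>s i \<omega>))"

end

theory Submission
  imports Defs
begin

text \<open>
  Both estimates have the same source. Strong convexity turns a perturbation of the gradient at the
  solution into a bound on the displacement of the solution: for every sample,
  \<open>\<alpha> * norm (u\<^sup>* - u\<^sub>N) \<le> norm (S / N)\<close>, where \<open>S\<close> is the sum of the gradient errors
  \<open>Z\<^sub>i = \<nabla>J(u\<^sup>*, \<xi>\<^sup>i) - \<nabla>F(u\<^sup>*)\<close> (\<open>solution_distance_le_gradient_distance\<close>). The right side involves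
  gradients at the fixed point \<open>u\<^sup>*\<close> only, so that \<open>S\<close> is a sum of independent terms even though \<open>u\<^sub>N\<close>
  depends on the whole sample. The errors are also centered, because the subgradient inequality may be integrated
  (\<open>integral_subgradient_eq_derivative\<close>). It remains to bound a sum of independent centered random
  elements of a Hilbert space.

  In mean square, orthogonality gives \<open>E (norm S)\<^sup>2 = E (norm Z\<^sub>1)\<^sup>2 + \<dots> + E (norm Z\<^sub>N)\<^sup>2 \<le> N * \<sigma>\<^sup>2\<close>
  (\<open>second_moment_sum_indep_centered\<close>).

  For the tail bound, the elementary inequality
  \<open>cosh (norm (s + x)) \<le> cosh (norm s) * (exp (norm x) - norm x) + c(s) * (s \<bullet> x)\<close>
  (\<open>cosh_norm_add_le\<close>) makes \<open>E (cosh (l * norm S))\<close> submultiplicative, as the term linear in \<open>x\<close> has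
  expectation zero. The sub-Gaussian hypothesis and \<open>exp x - x \<le> exp (9/16 * x\<^sup>2)\<close> bound each factor by
  \<open>exp (3/4 * l\<^sup>2 * \<tau>\<^sup>2)\<close> (\<open>exp_moment_of_subgaussian\<close>), and Chernoff's method with the optimal \<open>l\<close> gives the
  constant 3 in the exponent (\<open>subgaussian_tail_sum_indep_centered\<close>).

  Measurability of the sample solution is obtained by approximating it with near-minimizers chosen
  measurably from a countable set (\<open>solution_measurable\<close>).
\<close>

section \<open>Gradients in Hilbert space\<close>

text \<open>The representing element is the minimizer of \<open>q x = (norm x)\<^sup>2 / 2 - D x\<close>: a minimizing sequence is
Cauchy, hence converges, and stationarity of \<open>q\<close> at the limit \<open>g\<close> reads \<open>D h = g \<bullet> h\<close>.\<close>

lemma riesz_representation: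
  fixes D :: "'u :: {real_inner, complete_space} \<Rightarrow> real"
  assumes "bounded_linear D"
  shows "\<exists>g. \<forall>h. D h = g \<bullet> h"
proof -
  interpret D: bounded_linear D by fact
  define q where "q x = (norm x)\<^sup>2 / 2 - D x" for x
  obtain B where B: "\<And>x. \<bar>D x\<bar> \<le> norm x * B"
    using D.bounded by auto
  have "- (B\<^sup>2 / 2) \<le> q x" for x
    using B[of x] zero_le_power2[of "norm x - B"]
    unfolding q_def by (simp add: power2_eq_square algebra_simps)
  then have bdd: "bdd_below (range q)"
    by (intro bdd_belowI[of _ "- (B\<^sup>2 / 2)"]) auto
  define m where "m = Inf (range q)"
  have m_le: "m \<le> q x" for x
    unfolding m_def using bdd by (intro cInf_lower) auto
  have "\<exists>x. q x < m + 1 / real (Suc n)" for n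
    using cInf_lessD[of "range q" "m + 1 / real (Suc n)"] unfolding m_def by auto
  then obtain x where x: "\<And>n. q (x n) < m + 1 / real (Suc n)"
    by metis
  \<comment> \<open>The parallelogram law makes near-minimizers of \<open>q\<close> close to each other.\<close>
  have gap: "(norm (y - z))\<^sup>2 \<le> 4 * (q y - m) + 4 * (q z - m)" for y z
  proof -
    have "q ((1 / 2) *\<^sub>R (y + z)) = (q y + q z) / 2 - (norm (y - z))\<^sup>2 / 8"
      unfolding q_def
      by (simp add: D.scaleR D.add power2_norm_eq_inner inner_add_left inner_add_right
          inner_diff_left inner_diff_right inner_commute field_simps)
    then show ?thesis
      using m_le[of "(1 / 2) *\<^sub>R (y + z)"] by (simp add: field_simps)
  qed
  have "Cauchy x"
  proof (rule metric_CauchyI)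
    fix e :: real
    assume "0 < e"
    then obtain n0 where n0: "8 / e\<^sup>2 < real n0"
      using reals_Archimedean2 by blast
    have "dist (x i) (x j) < e" if ij: "i \<ge> n0" "j \<ge> n0" for i j
    proof -
      have small: "q (x k) - m < e\<^sup>2 / 8" if "k \<ge> n0" for k
      proof -
        have "8 / e\<^sup>2 < real (Suc k)"
          using n0 that by linarith
        then have "1 / real (Suc k) \<le> e\<^sup>2 / 8"
          using \<open>0 < e\<close> by (simp add: field_simps)
        then show ?thesis
          using x[of k] by simp
      qed
      have "(norm (x i - x j))\<^sup>2 < e\<^sup>2"
        using gap[of "x i" "x j"] small[OF ij(1)] small[OF ij(2)] by simp
      then show ?thesis
        using \<open>0 < e\<close> by (simp add: dist_norm power_less_imp_less_base)
    qed
    then show "\<exists>n0. \<forall>i\<ge>n0. \<forall>j\<ge>n0. dist (x i) (x j) < e"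
      by blast
  qed
  then obtain g where g: "x \<longlonglongrightarrow> g"
    using Cauchy_convergent convergent_def by blast
  have "q g \<le> m"
  proof (rule LIMSEQ_le)
    show "(\<lambda>n. q (x n)) \<longlonglongrightarrow> q g"
      unfolding q_def by (intro tendsto_intros D.tendsto g) simp
    show "(\<lambda>n. m + 1 / real (Suc n)) \<longlonglongrightarrow> m"
      using tendsto_add[OF tendsto_const LIMSEQ_inverse_real_of_nat, of m]
      by (simp add: inverse_eq_divide)
  qed (use x in \<open>auto intro: less_imp_le\<close>)
  have "D h = g \<bullet> h" for h
  proof (cases "h = 0")
    case False
    \<comment> \<open>The step \<open>t\<close> minimizes the quadratic \<open>q (g + t *\<^sub>R h)\<close>, so that any \<open>c \<noteq> 0\<close> would strictly decrease \<open>q\<close>.\<close>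
    define c t where "c = g \<bullet> h - D h" and "t = - c / (norm h)\<^sup>2"
    have "q g \<le> q (g + t *\<^sub>R h)"
      using \<open>q g \<le> m\<close> m_le order_trans by blast
    also have "q (g + t *\<^sub>R h) = q g + t * c + t\<^sup>2 * (norm h)\<^sup>2 / 2"
    proof -
      have "(norm (g + t *\<^sub>R h))\<^sup>2 = (norm g)\<^sup>2 + 2 * t * (g \<bullet> h) + t * t * (norm h)\<^sup>2"
        by (simp add: power2_norm_eq_inner inner_add_left inner_add_right inner_commute)
      then show ?thesis
        unfolding q_def c_def
        by (simp add: D.scaleR D.add add_divide_distrib right_diff_distrib power2_eq_square)
    qed
    also have "\<dots> = q g - c\<^sup>2 / (2 * (norm h)\<^sup>2)"
      using False by (simp add: t_def field_simps power2_eq_square)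
    finally have "c\<^sup>2 \<le> 0"
      using False by (simp add: field_simps divide_le_0_iff)
    then show ?thesis
      by (simp add: c_def)
  qed (simp add: D.zero)
  then show ?thesis
    by blast
qed

lemma has_gateaux_derivative_unique:
  assumes "has_gateaux_derivative f D u" "has_gateaux_derivative f E u"
  shows "D = E"
proof
  fix h
  have "ereal (D h) = ereal (E h)"
    using assms unfolding has_gateaux_derivative_def
    by (metis (no_types, lifting) tendsto_unique[OF trivial_limit_at])
  then show "D h = E h"
    by simp
qed

text \<open>Riesz representation makes the description that defines \<^const>\<open>gradient\<close> meaningful.\<close>

lemma has_gateaux_derivative_gradient:
  fixes f :: "'u :: {real_inner, complete_space} \<Rightarrow> ereal"
  assumes "gateaux_differentiable f u"
  shows "has_gateaux_derivative f (\<lambda>h. gradient f u \<bullet> h) u"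
proof -
  obtain D where D: "has_gateaux_derivative f D u"
    using assms by (auto simp: gateaux_differentiable_def)
  then obtain g where "\<forall>h. D h = g \<bullet> h"
    using riesz_representation[of D] by (auto simp: has_gateaux_derivative_def)
  then have "D = (\<lambda>h. g \<bullet> h)"
    by auto
  with D have g: "has_gateaux_derivative f (\<lambda>h. g \<bullet> h) u"
    by simp
  then show ?thesis
    unfolding gradient_def
  proof (rule theI)
    fix g' assume "has_gateaux_derivative f (\<lambda>h. g' \<bullet> h) u"
    then have "g' \<bullet> (g' - g) = g \<bullet> (g' - g)"
      using has_gateaux_derivative_unique[OF _ g] by metis
    then have "(g' - g) \<bullet> (g' - g) = 0"
      by (simp add: inner_diff_left)
    then show "g' = g"
      by simp
  qed
qed

text \<open>Only a one-sided comparison along a ray is used, and \<open>f\<close> may be infinite on it: an infinite value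
only makes the difference quotient larger. This covers both the optimality condition of the
stochastic program and the interchange of gradient and expectation.\<close>

lemma gateaux_derivative_lower_bound:
  assumes D: "has_gateaux_derivative f D u"
    and le: "\<And>t. 0 < t \<Longrightarrow> t < 1 \<Longrightarrow> f u + ereal (t * c) \<le> f (u + t *\<^sub>R h)"
  shows "c \<le> D h"
proof -
  obtain r where r: "f u = ereal r"
    using D by (auto simp: has_gateaux_derivative_def)
  have "((\<lambda>t. (f (u + t *\<^sub>R h) - f u) / ereal t) \<longlongrightarrow> ereal (D h)) (at_right 0)"
    using D unfolding has_gateaux_derivative_def
    by (meson filterlim_mono order_refl at_le subset_UNIV)
  moreover have "\<forall>\<^sub>F t in at_right 0. ereal c \<le> (f (u + t *\<^sub>R h) - f u) / ereal t"
    unfolding eventually_at_right_field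
  proof (intro exI[of _ 1] conjI allI impI)
    fix t :: real
    assume t: "0 < t" "t < 1"
    show "ereal c \<le> (f (u + t *\<^sub>R h) - f u) / ereal t"
      using le[OF t] t r by (cases "f (u + t *\<^sub>R h)") (auto simp: field_simps)
  qed simp
  ultimately have "ereal c \<le> ereal (D h)"
    by (rule tendsto_lowerbound) simp
  then show ?thesis
    by simp
qed

section \<open>Strong convexity and stability of minimizers\<close>

lemma strongly_convexD:
  fixes g :: "'u :: real_inner \<Rightarrow> real"
  assumes "strongly_convex \<alpha> g" "0 \<le> t" "t \<le> 1"
  shows "g ((1 - t) *\<^sub>R u + t *\<^sub>R v) \<le>
    (1 - t) * g u + t * g v - \<alpha> / 2 * (t * (1 - t)) * (norm (v - u))\<^sup>2"
proof -
  let ?w = "(1 - t) *\<^sub>R u + t *\<^sub>R v"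
  define c where "c = \<alpha> / 2"
  have "g ?w \<le> c * (norm ?w)\<^sup>2 +
      ((1 - t) * (g u - c * (norm u)\<^sup>2) + t * (g v - c * (norm v)\<^sup>2))"
    using convex_onD[OF assms(1)[unfolded strongly_convex_def], of t u v] assms by (simp add: c_def)
  also have "(norm ?w)\<^sup>2 =
      (1 - t) * (norm u)\<^sup>2 + t * (norm v)\<^sup>2 - (t * (1 - t)) * (norm (v - u))\<^sup>2"
  proof -
    have 1: "(norm ?w)\<^sup>2 = (1 - t) * (1 - t) * (norm u)\<^sup>2 + 2 * (1 - t) * t * (u \<bullet> v) + t * t * (norm v)\<^sup>2"
      by (simp add: power2_norm_eq_inner inner_add_left inner_add_right inner_commute[of v u])
        algebra
    have 2: "(norm (v - u))\<^sup>2 = (norm u)\<^sup>2 - 2 * (u \<bullet> v) + (norm v)\<^sup>2"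
      by (simp add: power2_norm_eq_inner inner_diff_left inner_diff_right inner_commute[of v u])
    show ?thesis
      unfolding 1 2 by (simp add: algebra_simps)
  qed
  also have "c * ((1 - t) * (norm u)\<^sup>2 + t * (norm v)\<^sup>2 - (t * (1 - t)) * (norm (v - u))\<^sup>2) +
      ((1 - t) * (g u - c * (norm u)\<^sup>2) + t * (g v - c * (norm v)\<^sup>2)) =
      (1 - t) * g u + t * g v - c * (t * (1 - t)) * (norm (v - u))\<^sup>2"
    by (simp add: algebra_simps)
  finally show ?thesis
    by (simp only: c_def)
qed

lemma strongly_convex_ge_gateaux_derivative:
  fixes g :: "'u :: real_inner \<Rightarrow> real"
  assumes sc: "strongly_convex \<alpha> g" and D: "has_gateaux_derivative (\<lambda>v. ereal (g v)) D u"
  shows "g u + D (v - u) + \<alpha> / 2 * (norm (v - u))\<^sup>2 \<le> g v"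
proof -
  have "((\<lambda>t. ereal ((g (u + t *\<^sub>R (v - u)) - g u) / t)) \<longlongrightarrow> ereal (D (v - u))) (at 0)"
  proof (rule Lim_transform_eventually)
    show "((\<lambda>t. (ereal (g (u + t *\<^sub>R (v - u))) - ereal (g u)) / ereal t) \<longlongrightarrow> ereal (D (v - u))) (at 0)"
      using D by (simp add: has_gateaux_derivative_def del: ereal_minus)
    show "\<forall>\<^sub>F t in at 0. (ereal (g (u + t *\<^sub>R (v - u))) - ereal (g u)) / ereal t =
        ereal ((g (u + t *\<^sub>R (v - u)) - g u) / t)"
      by (auto simp: eventually_at_filter)
  qed
  then have "((\<lambda>t. (g (u + t *\<^sub>R (v - u)) - g u) / t) \<longlongrightarrow> D (v - u)) (at_right 0)"
    by (simp add: tendsto_mono[OF at_le[OF subset_UNIV]])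
  moreover have "((\<lambda>t. g v - g u - \<alpha> / 2 * (1 - t) * (norm (v - u))\<^sup>2) \<longlongrightarrow>
      g v - g u - \<alpha> / 2 * (1 - 0) * (norm (v - u))\<^sup>2) (at_right 0)"
    by (intro tendsto_intros)
  moreover have "\<forall>\<^sub>F t in at_right 0. (g (u + t *\<^sub>R (v - u)) - g u) / t \<le>
      g v - g u - \<alpha> / 2 * (1 - t) * (norm (v - u))\<^sup>2"
    unfolding eventually_at_right_field
  proof (intro exI[of _ 1] conjI allI impI)
    fix t :: real
    assume t: "0 < t" "t < 1"
    have "u + t *\<^sub>R (v - u) = (1 - t) *\<^sub>R u + t *\<^sub>R v"
      by (simp add: algebra_simps)
    then have "g (u + t *\<^sub>R (v - u)) \<le>
        (1 - t) * g u + t * g v - \<alpha> / 2 * (t * (1 - t)) * (norm (v - u))\<^sup>2"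
      using strongly_convexD[OF sc, of t u v] t by simp
    then have "g (u + t *\<^sub>R (v - u)) - g u \<le> t * (g v - g u - \<alpha> / 2 * (1 - t) * (norm (v - u))\<^sup>2)"
      by (simp add: algebra_simps)
    then show "(g (u + t *\<^sub>R (v - u)) - g u) / t \<le> g v - g u - \<alpha> / 2 * (1 - t) * (norm (v - u))\<^sup>2"
      using t by (simp add: divide_le_eq mult.commute)
  qed simp
  ultimately have "D (v - u) \<le> g v - g u - \<alpha> / 2 * (1 - 0) * (norm (v - u))\<^sup>2"
    by (intro tendsto_le[where F = "at_right (0::real)"]) auto
  then show ?thesis
    by simp
qed

lemma solution_summands_finite:
  assumes "solution (\<lambda>u. F u + \<Psi> u) u" "F u \<noteq> - \<infinity>" "\<Psi> u \<noteq> - \<infinity>"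
  shows "\<bar>F u\<bar> \<noteq> \<infinity>" "\<bar>\<Psi> u\<bar> \<noteq> \<infinity>"
  using assms by (cases "F u"; cases "\<Psi> u"; simp add: solution_def)+

lemma ext_convex_segment_le:
  assumes "ext_convex \<Psi>" "\<Psi> u = ereal p" "\<Psi> v = ereal q" "0 \<le> t" "t \<le> 1"
  shows "\<Psi> (u + t *\<^sub>R (v - u)) \<le> ereal ((1 - t) * p + t * q)"
proof -
  have "u + t *\<^sub>R (v - u) = (1 - t) *\<^sub>R u + t *\<^sub>R v"
    by (simp add: algebra_simps)
  then show ?thesis
    using assms unfolding ext_convex_def by (metis atLeastAtMost_iff plus_ereal.simps(1) times_ereal.simps(1))
qed

text \<open>Minimality is compared along the segment from \<open>m\<close> to \<open>v\<close>. After division by the step size the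
strong convexity term \<open>\<alpha> / 2 * (1 - t) * (norm (v - m))\<^sup>2\<close> survives as the step size tends to 0.\<close>

lemma solution_quadratic_growth:
  fixes g :: "'u :: real_inner \<Rightarrow> real"
  assumes sc: "strongly_convex \<alpha> g" and cv: "ext_convex \<Psi>"
    and sol: "solution (\<lambda>u. ereal (g u) + \<Psi> u) m"
    and \<Psi>: "\<Psi> m = ereal p" "\<Psi> v = ereal q"
  shows "g m + p + \<alpha> / 2 * (norm (v - m))\<^sup>2 \<le> g v + q"
proof -
  have le: "g m + p \<le> g v + q - \<alpha> / 2 * (1 - t) * (norm (v - m))\<^sup>2" if t: "0 < t" "t < 1" for t
  proof -
    let ?w = "m + t *\<^sub>R (v - m)"
    have "ereal (g m) + \<Psi> m \<le> ereal (g ?w) + \<Psi> ?w"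
      using sol by (auto simp: solution_def)
    also have "\<dots> \<le> ereal (g ?w) + ereal ((1 - t) * p + t * q)"
      using t by (intro add_left_mono ext_convex_segment_le[OF cv \<Psi>]) auto
    finally have "g m + p \<le> g ?w + ((1 - t) * p + t * q)"
      using \<Psi> by simp
    moreover have "?w = (1 - t) *\<^sub>R m + t *\<^sub>R v"
      by (simp add: algebra_simps)
    then have "g ?w \<le> (1 - t) * g m + t * g v - \<alpha> / 2 * (t * (1 - t)) * (norm (v - m))\<^sup>2"
      using strongly_convexD[OF sc, of t m v] t by simp
    ultimately have "t * (g m + p) \<le> t * (g v + q - \<alpha> / 2 * (1 - t) * (norm (v - m))\<^sup>2)"
      by (simp add: algebra_simps)
    then show ?thesis
      using t by simp
  qed
  have "g m + p \<le> g v + q - \<alpha> / 2 * (1 - 0) * (norm (v - m))\<^sup>2"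
  proof (rule tendsto_lowerbound)
    show "((\<lambda>t. g v + q - \<alpha> / 2 * (1 - t) * (norm (v - m))\<^sup>2) \<longlongrightarrow>
        g v + q - \<alpha> / 2 * (1 - 0) * (norm (v - m))\<^sup>2) (at_right 0)"
      by (intro tendsto_intros)
    show "\<forall>\<^sub>F t in at_right 0. g m + p \<le> g v + q - \<alpha> / 2 * (1 - t) * (norm (v - m))\<^sup>2"
      unfolding eventually_at_right_field using le by (intro exI[of _ 1]) auto
  qed simp
  then show ?thesis
    by simp
qed

text \<open>The first-order optimality condition \<open>- D \<in> \<partial> \<Psi>(u)\<close>: on the segment towards \<open>w\<close>, the decrease of the
convex part \<open>\<Psi>\<close> is at least linear, and has to be compensated by \<open>F\<close>.\<close>

lemma solution_variational_inequality:
  assumes D: "has_gateaux_derivative F D u" and cv: "ext_convex \<Psi>"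
    and sol: "solution (\<lambda>u. F u + \<Psi> u) u"
    and \<Psi>: "\<Psi> u = ereal p" "\<Psi> w = ereal q"
  shows "p - q \<le> D (w - u)"
proof (rule gateaux_derivative_lower_bound[OF D])
  fix t :: real
  assume t: "0 < t" "t < 1"
  let ?v = "u + t *\<^sub>R (w - u)"
  obtain r where r: "F u = ereal r"
    using D by (auto simp: has_gateaux_derivative_def)
  have "F u + \<Psi> u \<le> F ?v + \<Psi> ?v"
    using sol by (auto simp: solution_def)
  also have "\<dots> \<le> F ?v + ereal ((1 - t) * p + t * q)"
    using t by (intro add_left_mono ext_convex_segment_le[OF cv \<Psi>]) auto
  finally show "F u + ereal (t * (p - q)) \<le> F ?v"
    using r \<Psi> by (cases "F ?v") (auto simp: algebra_simps)
qed

text \<open>The deterministic core: the minimizers \<open>u\<close> of \<open>F + \<Psi>\<close> and \<open>m\<close> of \<open>g + \<Psi>\<close> are no further apart than the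
gradients of \<open>F\<close> and \<open>g\<close> at \<open>u\<close>, up to the factor \<open>1 / \<alpha>\<close>. Adding the optimality condition of \<open>u\<close>, the
quadratic growth of \<open>g + \<Psi>\<close> around \<open>m\<close> and the strong subgradient inequality of \<open>g\<close> at \<open>u\<close>, all
function values cancel and \<open>\<alpha> * (norm (u - m))\<^sup>2 \<le> (b - a) \<bullet> (u - m)\<close> remains. Each of the last two
inequalities contributes one half of the left side.\<close>

lemma solution_distance_le_gradient_distance:
  fixes g :: "'u :: real_inner \<Rightarrow> real"
  assumes sc: "strongly_convex \<alpha> g" and cv: "ext_convex \<Psi>"
    and F: "has_gateaux_derivative F (\<lambda>h. a \<bullet> h) u" "solution (\<lambda>u. F u + \<Psi> u) u"
    and g: "solution (\<lambda>u. ereal (g u) + \<Psi> u) m"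
    and b: "\<And>v. g u + b \<bullet> (v - u) + \<alpha> / 2 * (norm (v - u))\<^sup>2 \<le> g v"
    and \<Psi>: "\<And>u. \<Psi> u \<noteq> - \<infinity>"
  shows "\<alpha> * norm (u - m) \<le> norm (b - a)"
proof (cases "u = m")
  case False
  have "F u \<noteq> - \<infinity>"
    using F(1) by (auto simp: has_gateaux_derivative_def)
  then obtain p q where \<Psi>pq: "\<Psi> u = ereal p" "\<Psi> m = ereal q"
    using solution_summands_finite(2)[OF F(2) _ \<Psi>] solution_summands_finite(2)[OF g _ \<Psi>] by fastforce
  have "p - q \<le> a \<bullet> (m - u)"
    by (rule solution_variational_inequality[OF F(1) cv F(2) \<Psi>pq])
  moreover have "g m + q + \<alpha> / 2 * (norm (u - m))\<^sup>2 \<le> g u + p"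
    by (rule solution_quadratic_growth[OF sc cv g \<Psi>pq(2,1)])
  moreover note b[of m]
  ultimately have "\<alpha> * (norm (u - m))\<^sup>2 \<le> (b - a) \<bullet> (u - m)"
    by (simp add: norm_minus_commute[of m u] inner_diff_left inner_diff_right)
  also have "\<dots> \<le> norm (b - a) * norm (u - m)"
    by (rule norm_cauchy_schwarz)
  finally have "(\<alpha> * norm (u - m)) * norm (u - m) \<le> norm (b - a) * norm (u - m)"
    by (simp add: power2_eq_square)
  then show ?thesis
    using False by simp
qed simp

lemma strongly_convex_average:
  assumes "finite I" "I \<noteq> {}" and "\<And>i. i \<in> I \<Longrightarrow> strongly_convex \<alpha> (f i)"
  shows "strongly_convex \<alpha> (\<lambda>u. (1 / real (card I)) * (\<Sum>i\<in>I. f i u))"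
proof -
  have sum: "convex_on UNIV (\<lambda>u. \<Sum>i\<in>I. f i u - \<alpha> / 2 * (norm u)\<^sup>2)"
    using assms(1,3)
  proof (induction I rule: finite_induct)
    case (insert i I)
    then show ?case
      by (simp add: convex_on_add strongly_convex_def)
  qed (simp add: convex_on_const)
  have "(1 / real (card I)) * (\<Sum>i\<in>I. f i u) - \<alpha> / 2 * (norm u)\<^sup>2 =
      (1 / real (card I)) * (\<Sum>i\<in>I. f i u - \<alpha> / 2 * (norm u)\<^sup>2)" for u
    using assms(1,2) by (simp add: sum_subtractf right_diff_distrib)
  then show ?thesis
    unfolding strongly_convex_def using convex_on_cmul[OF _ sum, of "1 / real (card I)"] by simp
qed

section \<open>Measurability of minimizers\<close>

text \<open>The function \<open>\<Psi>\<close> need not be continuous, so a dense subset of its domain does not suffice to detect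
the minimum. A countable dense subset \<open>(v k, s k)\<close> of its graph does: near \<open>(m \<omega>, \<Psi> (m \<omega>))\<close> it has
points with nearly minimal objective value \<open>G (v k) \<omega> + s k\<close>. Choosing the first index that is
optimal up to \<open>1 / (n + 1)\<close> gives a measurable map, and quadratic growth forces these maps to
converge to \<open>m\<close>.\<close>

lemma solution_measurable:
  fixes G :: "'u :: {real_inner, second_countable_topology} \<Rightarrow> 'w \<Rightarrow> real"
  assumes \<alpha>: "0 < \<alpha>"
    and meas [measurable]: "\<And>v. G v \<in> borel_measurable M"
    and cont: "\<And>\<omega>. \<omega> \<in> space M \<Longrightarrow> continuous_on UNIV (\<lambda>v. G v \<omega>)"
    and sc: "\<And>\<omega>. \<omega> \<in> space M \<Longrightarrow> strongly_convex \<alpha> (\<lambda>v. G v \<omega>)"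
    and \<Psi>: "ext_convex \<Psi>" "proper \<Psi>"
    and sol: "\<And>\<omega>. \<omega> \<in> space M \<Longrightarrow> solution (\<lambda>v. ereal (G v \<omega>) + \<Psi> v) (m \<omega>)"
  shows "m \<in> borel_measurable M"
proof -
  define E where "E = {(v, s). \<Psi> v = ereal s}"
  obtain C where C: "countable C" "C \<subseteq> E" "E \<subseteq> closure C"
    using separable[of E] by metis
  have "E \<noteq> {}"
  proof -
    obtain v where "\<bar>\<Psi> v\<bar> \<noteq> \<infinity>"
      using \<Psi>(2) unfolding proper_def eff_dom_def by force
    then show ?thesis
      unfolding E_def by (cases "\<Psi> v") auto
  qed
  then have "C \<noteq> {}"
    using C(3) by auto
  define v s where "v k = fst (from_nat_into C k)" and "s k = snd (from_nat_into C k)" for k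
  have vs: "\<Psi> (v k) = ereal (s k)" for k
    using from_nat_into[OF \<open>C \<noteq> {}\<close>, of k] C(2) unfolding E_def v_def s_def by auto
  have \<Psi>_m: "\<exists>p. \<Psi> (m \<omega>) = ereal p" if "\<omega> \<in> space M" for \<omega>
    using solution_summands_finite(2)[OF sol[OF that]] \<Psi>(2) by (cases "\<Psi> (m \<omega>)") (auto simp: proper_def)
  define \<mu> where "\<mu> \<omega> = G (m \<omega>) \<omega> + real_of_ereal (\<Psi> (m \<omega>))" for \<omega>
  have growth: "\<mu> \<omega> + \<alpha> / 2 * (norm (v k - m \<omega>))\<^sup>2 \<le> G (v k) \<omega> + s k" if "\<omega> \<in> space M" for k \<omega>
    using solution_quadratic_growth[OF sc \<Psi>(1) sol, OF that that _ vs] \<Psi>_m[OF that]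
    by (auto simp: \<mu>_def)
  have near: "\<exists>k. G (v k) \<omega> + s k < \<mu> \<omega> + e" if e: "0 < e" and \<omega>: "\<omega> \<in> space M" for e \<omega>
  proof -
    have "continuous_on UNIV (\<lambda>x. G (fst x) \<omega> + snd x)"
      using cont[OF \<omega>]
      by (intro continuous_intros continuous_on_compose2[OF _ continuous_on_fst]) auto
    then have "open {x. G (fst x) \<omega> + snd x < \<mu> \<omega> + e}"
      by (intro open_Collect_less continuous_on_const)
    moreover obtain p where "\<Psi> (m \<omega>) = ereal p"
      using \<Psi>_m[OF \<omega>] by blast
    then have "(m \<omega>, p) \<in> closure C" "(m \<omega>, p) \<in> {x. G (fst x) \<omega> + snd x < \<mu> \<omega> + e}"
      using C(3) e by (auto simp: E_def \<mu>_def)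
    ultimately obtain x where x: "x \<in> C" "G (fst x) \<omega> + snd x < \<mu> \<omega> + e"
      using open_Int_closure_eq_empty by blast
    then show ?thesis
      using from_nat_into_surj[OF C(1) x(1)] unfolding v_def s_def by auto
  qed
  \<comment> \<open>Near-optimality is tested against the countable family instead of the optimal value \<open>\<mu>\<close>: this makes the condition measurable.\<close>
  define k where "k n \<omega> = (LEAST i. \<forall>j. G (v i) \<omega> + s i \<le> G (v j) \<omega> + s j + 1 / real (Suc n))" for n \<omega>
  have [measurable]: "k n \<in> measurable M (count_space UNIV)" for n
    unfolding k_def by measurable
  have k: "G (v (k n \<omega>)) \<omega> + s (k n \<omega>) \<le> \<mu> \<omega> + 1 / real (Suc n)" if \<omega>: "\<omega> \<in> space M" for n \<omega>
  proof -
    obtain i where "G (v i) \<omega> + s i < \<mu> \<omega> + 1 / real (Suc n)"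
      using near[OF _ \<omega>, of "1 / real (Suc n)"] by auto
    moreover have "\<mu> \<omega> \<le> G (v j) \<omega> + s j" for j
      using growth[OF \<omega>, of j] \<alpha> by (smt (verit) half_gt_zero mult_nonneg_nonneg zero_le_power2)
    ultimately have "\<exists>i. \<forall>j. G (v i) \<omega> + s i \<le> G (v j) \<omega> + s j + 1 / real (Suc n)"
      by (smt (verit))
    then have *: "\<forall>j. G (v (k n \<omega>)) \<omega> + s (k n \<omega>) \<le> G (v j) \<omega> + s j + 1 / real (Suc n)"
      unfolding k_def by (rule LeastI_ex)
    show ?thesis
    proof (rule field_le_epsilon)
      fix e :: real
      assume "0 < e"
      then obtain j where "G (v j) \<omega> + s j < \<mu> \<omega> + e"
        using near \<omega> by blast
      then show "G (v (k n \<omega>)) \<omega> + s (k n \<omega>) \<le> \<mu> \<omega> + 1 / real (Suc n) + e"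
        using *[rule_format, of j] by linarith
    qed
  qed
  show ?thesis
  proof (rule borel_measurable_LIMSEQ_metric)
    show "(\<lambda>\<omega>. v (k n \<omega>)) \<in> borel_measurable M" for n
      by (rule measurable_compose_countable[where f = "\<lambda>i _. v i"]) auto
    show "(\<lambda>n. v (k n \<omega>)) \<longlonglongrightarrow> m \<omega>" if \<omega>: "\<omega> \<in> space M" for \<omega>
    proof -
      have lim: "(\<lambda>n. sqrt (2 / \<alpha> * (1 / real (Suc n)))) \<longlonglongrightarrow> sqrt (2 / \<alpha> * 0)"
        using LIMSEQ_inverse_real_of_nat by (intro tendsto_intros) (simp add: inverse_eq_divide)
      have bound: "norm (v (k n \<omega>) - m \<omega>) \<le> sqrt (2 / \<alpha> * (1 / real (Suc n)))" for n
      proof (rule real_le_rsqrt)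
        have "\<alpha> / 2 * (norm (v (k n \<omega>) - m \<omega>))\<^sup>2 \<le> 1 / real (Suc n)"
          using k[OF \<omega>, of n] growth[OF \<omega>, of "k n \<omega>"] by linarith
        then have "2 / \<alpha> * (\<alpha> / 2 * (norm (v (k n \<omega>) - m \<omega>))\<^sup>2) \<le> 2 / \<alpha> * (1 / real (Suc n))"
          using \<alpha> by (intro mult_left_mono) auto
        then show "(norm (v (k n \<omega>) - m \<omega>))\<^sup>2 \<le> 2 / \<alpha> * (1 / real (Suc n))"
          using \<alpha> by simp
      qed
      have "(\<lambda>n. v (k n \<omega>) - m \<omega>) \<longlonglongrightarrow> 0"
        by (rule Lim_null_comparison[OF always_eventually[OF allI[OF bound]]]) (use lim in simp)
      then show ?thesis
        by (simp add: LIM_zero_iff)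
    qed
  qed
qed

section \<open>Gradient and expectation\<close>

lemma ext_expectation_eq_integral:
  "integrable A X \<Longrightarrow> ext_expectation A X = ereal (\<integral>a. X a \<partial>A)"
  using real_lebesgue_integral_def[of A X] unfolding ext_expectation_def real_integrable_def
  by (cases "\<integral>\<^sup>+ a. ennreal (X a) \<partial>A"; cases "\<integral>\<^sup>+ a. ennreal (- X a) \<partial>A") auto

lemma ext_expectation_neq_MInfty: "expectation_defined A X \<Longrightarrow> ext_expectation A X \<noteq> - \<infinity>"
  unfolding ext_expectation_def expectation_defined_def
  by (cases "\<integral>\<^sup>+ a. ennreal (X a) \<partial>A"; cases "\<integral>\<^sup>+ a. ennreal (- X a) \<partial>A") auto

lemma integrable_if_ext_expectation_finite:
  "expectation_defined A X \<Longrightarrow> ext_expectation A X \<noteq> \<infinity> \<Longrightarrow> integrable A X"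
  unfolding ext_expectation_def expectation_defined_def real_integrable_def
  by (cases "\<integral>\<^sup>+ a. ennreal (X a) \<partial>A"; cases "\<integral>\<^sup>+ a. ennreal (- X a) \<partial>A") auto

text \<open>Convexity yields the interchange of gradient and expectation: integrating the subgradient
inequality bounds the difference quotients of \<open>F\<close> along \<open>h\<close> below by the integral of
\<open>h \<bullet> X\<close>. Hence this integral is at most \<open>D h\<close>, and the same for \<open>- h\<close> gives equality.\<close>

lemma integral_subgradient_eq_derivative:
  fixes J :: "'u :: real_inner \<Rightarrow> 'x \<Rightarrow> real"
  assumes F_defined: "\<And>v. expectation_defined A (\<lambda>a. J v (\<xi> a))"
    and D: "has_gateaux_derivative (expected_cost A \<xi> J) D u"
    and X: "\<And>a v. J u (\<xi> a) + X a \<bullet> (v - u) \<le> J v (\<xi> a)"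
    and int: "\<And>h. integrable A (\<lambda>a. h \<bullet> X a)"
  shows "(\<integral>a. h \<bullet> X a \<partial>A) = D h"
proof -
  have le: "(\<integral>a. h \<bullet> X a \<partial>A) \<le> D h" for h
  proof (rule gateaux_derivative_lower_bound[OF D])
    fix t :: real
    let ?v = "u + t *\<^sub>R h"
    have Ju: "integrable A (\<lambda>a. J u (\<xi> a))"
      using D F_defined unfolding has_gateaux_derivative_def expected_cost_def
      by (intro integrable_if_ext_expectation_finite) auto
    show "expected_cost A \<xi> J u + ereal (t * (\<integral>a. h \<bullet> X a \<partial>A)) \<le> expected_cost A \<xi> J ?v"
    proof (cases "expected_cost A \<xi> J ?v = \<infinity>")
      case False
      then have Jv: "integrable A (\<lambda>a. J ?v (\<xi> a))"
        using F_defined unfolding expected_cost_def by (intro integrable_if_ext_expectation_finite)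
      have "(\<integral>a. J u (\<xi> a) + t * (h \<bullet> X a) \<partial>A) \<le> (\<integral>a. J ?v (\<xi> a) \<partial>A)"
        using Ju Jv int X[of _ ?v] by (intro integral_mono) (auto simp: inner_commute)
      then show ?thesis
        using Ju Jv int by (simp add: expected_cost_def ext_expectation_eq_integral)
    qed simp
  qed
  interpret D: bounded_linear D
    using D by (simp add: has_gateaux_derivative_def)
  show ?thesis
    using le[of h] le[of "- h"] int[of h] by (simp add: D.neg)
qed

section \<open>Inequalities for exponential and hyperbolic functions\<close>

text \<open>For \<open>x \<ge> 16/9\<close> the exponent on the right is already at least \<open>x\<close>. Below that point both sides agree to
first order and come very close near \<open>x = 0.7\<close>, so they are compared by Taylor polynomials: degree
5 for \<open>exp x\<close>, with a remainder of at most \<open>x ^ 6 / 80\<close> as \<open>exp 2 \<le> 9\<close>, and degree 3 in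
\<open>9/16 * x\<^sup>2\<close> on the right.
The constant \<open>9/16\<close> is what makes the exponential moment bound below come out with the factor
\<open>3/4\<close>.\<close>

lemma exp_diff_le_exp_square:
  fixes x :: real
  assumes "0 \<le> x"
  shows "exp x - x \<le> exp (9 / 16 * x\<^sup>2)"
proof (cases "x \<le> 16 / 9")
  case False
  then have "x \<le> 9 / 16 * x\<^sup>2"
    by (simp add: power2_eq_square field_simps)
  then show ?thesis
    using assms by (smt (verit) exp_le_cancel_iff)
next
  case True
  obtain t where t: "\<bar>t\<bar> \<le> \<bar>x\<bar>" "exp x = (\<Sum>m<6. x ^ m / fact m) + exp t / fact 6 * x ^ 6"
    using Maclaurin_exp_le[of x 6] by auto
  have "exp t \<le> exp (2 * 1)"
    using t True assms by (subst exp_le_cancel_iff) auto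
  also have "\<dots> = (exp 1) ^ 2"
    by (subst exp_of_nat_mult[symmetric]) simp
  also have "\<dots> \<le> (3::real) ^ 2"
    by (intro power_mono exp_le) auto
  finally have "exp t / fact 6 * x ^ 6 \<le> 9 / fact 6 * x ^ 6"
    using assms by (intro mult_right_mono divide_right_mono) auto
  then have upper: "exp x \<le> 1 + x + x ^ 2 / 2 + x ^ 3 / 6 + x ^ 4 / 24 + x ^ 5 / 120 + x ^ 6 / 80"
    using t(2) by (simp add: eval_nat_numeral lessThan_Suc)
  define y where "y = 9 / 16 * x\<^sup>2"
  obtain s where "exp y = (\<Sum>m<4. y ^ m / fact m) + exp s / fact 4 * y ^ 4"
    using Maclaurin_exp_le[of y 4] by auto
  moreover have "0 \<le> exp s / fact 4 * y ^ 4"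
    by simp
  ultimately have lower: "exp y \<ge> 1 + y + y ^ 2 / 2 + y ^ 3 / 6"
    by (simp add: eval_nat_numeral lessThan_Suc)
  \<comment> \<open>Two quadratics without real roots certify that the difference of the Taylor polynomials is nonnegative; its coefficients of \<open>x ^ 4\<close> and \<open>x ^ 6\<close> are rounded down to \<open>(1153 + 11)/10000\<close> and \<open>1711/100000\<close>.\<close>
  have quad1: "0 \<le> 1 / 16 - x / 6 + 1153 / 10000 * x\<^sup>2"
    using zero_le_power2[of "x - 10000 / 6 / 2 / 1153"] by (simp add: power2_eq_square algebra_simps)
  have quad2: "0 \<le> 11 / 10000 - x / 120 + 1711 / 100000 * x\<^sup>2"
    using zero_le_power2[of "x - 100000 / 240 / 1711"] by (simp add: power2_eq_square algebra_simps)
  have "0 \<le> x\<^sup>2 * (1 / 16 - x / 6 + 1153 / 10000 * x\<^sup>2) +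
      x ^ 4 * (11 / 10000 - x / 120 + 1711 / 100000 * x\<^sup>2)"
    using quad1 quad2 by simp
  also have "\<dots> \<le> (1 + y + y ^ 2 / 2 + y ^ 3 / 6)
      - (1 + x ^ 2 / 2 + x ^ 3 / 6 + x ^ 4 / 24 + x ^ 5 / 120 + x ^ 6 / 80)"
    using zero_le_power2[of "x^2"] zero_le_power2[of "x^3"] unfolding y_def
    by (simp add: eval_nat_numeral algebra_simps)
  finally show ?thesis
    using upper lower unfolding y_def by linarith
qed

text \<open>The power series of \<open>cosh\<close> in the variable \<open>y = x\<^sup>2\<close> has nonnegative coefficients, and each power
of \<open>y\<close> is convex on the half-line.\<close>

lemma convex_on_cosh_sqrt: "convex_on {0..} (\<lambda>y. cosh (sqrt y))"
proof (rule convex_onI)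
  fix t y z :: real
  assume t: "0 < t" "t < 1" and yz: "y \<in> {0..}" "z \<in> {0..}"
  let ?w = "(1 - t) * y + t * z"
  have w: "0 \<le> ?w"
    using t yz by auto
  define c where "c = (\<lambda>(y::real) n. if even n then sqrt y ^ n /\<^sub>R fact n else 0)"
  have c: "c y n = (if even n then y ^ (n div 2) / fact n else 0)" if "0 \<le> y" for y n
    using that unfolding c_def by (auto elim!: evenE simp: power_mult divide_inverse)
  have term_le: "c ?w n \<le> (1 - t) * c y n + t * c z n" for n
  proof (cases "even n")
    case True
    have "convex_on {0..} (\<lambda>x::real. x ^ (n div 2))"
      by (cases "even (n div 2)") (auto intro: convex_power_odd convex_on_subset[OF convex_power_even])
    then have "?w ^ (n div 2) \<le> (1 - t) * y ^ (n div 2) + t * z ^ (n div 2)"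
      using convex_onD[of "{0..}" "\<lambda>x::real. x ^ (n div 2)" t y z] t yz by simp
    then have "?w ^ (n div 2) / fact n \<le> ((1 - t) * y ^ (n div 2) + t * z ^ (n div 2)) / fact n"
      by (rule divide_right_mono) simp
    then show ?thesis
      using True yz w by (simp add: c add_divide_distrib)
  qed (use yz w in \<open>simp add: c\<close>)
  have sums: "c y sums cosh (sqrt y)" for y
    unfolding c_def by (rule cosh_converges)
  have "cosh (sqrt ?w) \<le> (1 - t) * cosh (sqrt y) + t * cosh (sqrt z)"
    by (rule sums_le[OF term_le sums]) (intro sums_add sums_mult sums)
  then show "cosh (sqrt ((1 - t) *\<^sub>R y + t *\<^sub>R z)) \<le> (1 - t) * cosh (sqrt y) + t * cosh (sqrt z)"
    by simp
qed simp

lemma le_sinh_real: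
  fixes x :: real
  assumes "0 \<le> x"
  shows "x \<le> sinh x"
proof -
  have "sinh 0 - 0 \<le> sinh x - x"
  proof (rule DERIV_nonneg_imp_nondecreasing[OF assms])
    fix y :: real
    have "((\<lambda>y. sinh y - y) has_real_derivative cosh y - 1) (at y)"
      by (auto intro!: derivative_eq_intros)
    then show "\<exists>d. ((\<lambda>y. sinh y - y) has_real_derivative d) (at y) \<and> 0 \<le> d"
      using cosh_real_ge_1[of y] by (intro exI[of _ "cosh y - 1"]) simp
  qed
  then show ?thesis
    by simp
qed

text \<open>This bound replaces the smoothness estimate for \<open>cosh \<circ> norm\<close> in the argument of Pinelis. For fixed
values \<open>a = norm s\<close> and \<open>b = norm x\<close>, the left side is a convex function of \<open>s \<bullet> x\<close>, because
\<open>(norm (s + x))\<^sup>2\<close> is affine in \<open>s \<bullet> x\<close> and \<open>cosh (sqrt y)\<close> is convex in \<open>y\<close>; the right side is affine. So it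
suffices to compare at the extreme values \<open>s \<bullet> x = \<plusminus> a * b\<close>, where the left side is \<open>cosh (a \<plusminus> b)\<close> and the
claim reduces to \<open>\<plusminus> sinh a * (sinh b - b) \<le> cosh a * (sinh b - b)\<close>. The term linear in \<open>x\<close> vanishes in
expectation when \<open>x\<close> is centered and independent of \<open>s\<close>.\<close>

lemma cosh_norm_add_le:
  fixes s x :: "'u :: real_inner"
  shows "cosh (norm (s + x)) \<le>
    cosh (norm s) * (exp (norm x) - norm x) + sinh (norm s) / norm s * (s \<bullet> x)"
proof -
  \<comment> \<open>\<open>t\<close> locates \<open>s \<bullet> x\<close> between \<open>- a * b\<close> and \<open>a * b\<close>; if \<open>a * b = 0\<close>, division by zero gives \<open>t = 1/2\<close>, which is a valid choice.\<close>
  define a b t where "a = norm s" and "b = norm x" and "t = (1 + (s \<bullet> x) / (a * b)) / 2"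
  have ab: "0 \<le> a" "0 \<le> b"
    by (auto simp: a_def b_def)
  have inner: "s \<bullet> x = (2 * t - 1) * (a * b)"
  proof -
    have "2 * t - 1 = (s \<bullet> x) / (a * b)"
      unfolding t_def by algebra
    then show ?thesis
      by (cases "s = 0 \<or> x = 0") (auto simp: a_def b_def)
  qed
  have "\<bar>(s \<bullet> x) / (a * b)\<bar> \<le> 1"
    using Cauchy_Schwarz_ineq2[of s x] ab by (auto simp: a_def b_def field_simps divide_le_eq_1)
  then have t: "0 \<le> t" "t \<le> 1"
    unfolding t_def abs_le_iff by (auto simp: algebra_simps)
  have "(norm (s + x))\<^sup>2 = a\<^sup>2 + b\<^sup>2 + 2 * (s \<bullet> x)"
    unfolding a_def b_def
    by (simp add: power2_norm_eq_inner inner_add_left inner_add_right inner_commute)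
  also have "\<dots> = (1 - t) * (a - b)\<^sup>2 + t * (a + b)\<^sup>2"
    unfolding inner by (simp add: power2_eq_square algebra_simps)
  finally have "norm (s + x) = sqrt ((1 - t) * (a - b)\<^sup>2 + t * (a + b)\<^sup>2)"
    by (metis norm_ge_zero real_sqrt_unique)
  then have "cosh (norm (s + x)) \<le> (1 - t) * cosh (sqrt ((a - b)\<^sup>2)) + t * cosh (sqrt ((a + b)\<^sup>2))"
    using convex_onD[OF convex_on_cosh_sqrt, of t "(a - b)\<^sup>2" "(a + b)\<^sup>2"] t by simp
  also have "\<dots> = (1 - t) * cosh (a - b) + t * cosh (a + b)"
    by (simp add: cosh_real_abs)
  also have "\<dots> = cosh a * cosh b + (2 * t - 1) * (sinh a * sinh b)"
    by (simp add: cosh_add cosh_diff algebra_simps)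
  also have "\<dots> \<le> cosh a * (exp b - b) + sinh a * ((2 * t - 1) * b)"
  proof -
    have "0 \<le> sinh b - b"
      using le_sinh_real[OF ab(2)] by simp
    moreover have "sinh a * (2 * t - 1) \<le> cosh a"
    proof -
      have "sinh a * (2 * t - 1) \<le> sinh a * 1"
        using ab t by (intro mult_left_mono) auto
      also have "\<dots> \<le> cosh a"
        by (simp add: sinh_le_cosh_real)
      finally show ?thesis .
    qed
    ultimately have "sinh a * (2 * t - 1) * (sinh b - b) \<le> cosh a * (sinh b - b)"
      by (intro mult_right_mono)
    moreover have "exp b = cosh b + sinh b"
      by (simp add: cosh_plus_sinh)
    ultimately show ?thesis
      by (simp add: algebra_simps)
  qed
  also have "sinh a * ((2 * t - 1) * b) = sinh a / a * (s \<bullet> x)"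
    using inner by (cases "a = 0") auto
  finally show ?thesis
    by (simp add: a_def b_def)
qed

section \<open>Sums of independent centered random elements\<close>

context prob_space
begin

lemma indep_var_sum:
  fixes X :: "'i \<Rightarrow> 'a \<Rightarrow> 'u :: {real_normed_vector, second_countable_topology}"
  assumes "finite I" "i \<notin> I" and "indep_vars (\<lambda>_. borel) X (insert i I)"
  shows "indep_var borel (\<lambda>\<omega>. \<Sum>j\<in>I. X j \<omega>) borel (X i)"
proof -
  have "indep_var
      borel ((\<lambda>f. \<Sum>j\<in>I. f j) \<circ> (\<lambda>\<omega>. restrict (\<lambda>j. X j \<omega>) I))
      borel ((\<lambda>f. f i) \<circ> (\<lambda>\<omega>. restrict (\<lambda>j. X j \<omega>) {i}))"
    using assms by (intro indep_var_compose[OF indep_var_restrict[OF assms(3)]]) auto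
  also have "(\<lambda>f. f i) \<circ> (\<lambda>\<omega>. restrict (\<lambda>j. X j \<omega>) {i}) = X i"
    by auto
  also have "(\<lambda>f. \<Sum>j\<in>I. f j) \<circ> (\<lambda>\<omega>. restrict (\<lambda>j. X j \<omega>) I) = (\<lambda>\<omega>. \<Sum>j\<in>I. X j \<omega>)"
    by (auto cong: rev_conj_cong)
  finally show ?thesis .
qed

text \<open>Under the product law of \<open>(X, Y)\<close>, the inner integral over \<open>Y\<close> is the centering condition for the
direction \<open>h = X\<close>. Centering is expressed weakly, through the real integrals of \<open>h \<bullet> Y\<close>.\<close>

lemma
  fixes X Y :: "'a \<Rightarrow> 'u :: {real_inner, second_countable_topology}"
  assumes indep: "indep_var borel X borel Y"
    and X: "integrable M (\<lambda>\<omega>. norm (X \<omega>))" and Y: "integrable M (\<lambda>\<omega>. norm (Y \<omega>))"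
    and centered: "\<And>h. (\<integral>\<omega>. h \<bullet> Y \<omega> \<partial>M) = 0"
  shows integrable_inner_indep: "integrable M (\<lambda>\<omega>. X \<omega> \<bullet> Y \<omega>)"
    and integral_inner_indep_centered: "(\<integral>\<omega>. X \<omega> \<bullet> Y \<omega> \<partial>M) = 0"
proof -
  have [measurable]: "X \<in> borel_measurable M" "Y \<in> borel_measurable M"
    using indep_var_rv1[OF indep] indep_var_rv2[OF indep] by auto
  have "indep_var borel (norm \<circ> X) borel (norm \<circ> Y)"
    by (rule indep_var_compose[OF indep]) auto
  then have "integrable M (\<lambda>\<omega>. norm (X \<omega>) * norm (Y \<omega>))"
    using X Y indep_var_integrable[of "norm \<circ> X" "norm \<circ> Y"] by (simp add: comp_def)
  then show int: "integrable M (\<lambda>\<omega>. X \<omega> \<bullet> Y \<omega>)"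
    by (rule Bochner_Integration.integrable_bound) (auto simp: Cauchy_Schwarz_ineq2)
  interpret P: prob_space "distr M borel X"
    by (rule prob_space_distr) simp
  interpret Q: prob_space "distr M borel Y"
    by (rule prob_space_distr) simp
  interpret PQ: pair_prob_space "distr M borel X" "distr M borel Y" ..
  have joint: "distr M borel X \<Otimes>\<^sub>M distr M borel Y = distr M (borel \<Otimes>\<^sub>M borel) (\<lambda>\<omega>. (X \<omega>, Y \<omega>))"
    using indep by (simp add: indep_var_distribution_eq)
  have "(\<integral>\<omega>. X \<omega> \<bullet> Y \<omega> \<partial>M) = (\<integral>p. fst p \<bullet> snd p \<partial>(distr M borel X \<Otimes>\<^sub>M distr M borel Y))"
    unfolding joint by (subst integral_distr) auto
  also have "\<dots> = (\<integral>x. \<integral>y. x \<bullet> y \<partial>distr M borel Y \<partial>distr M borel X)"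
  proof -
    have "integrable (distr M borel X \<Otimes>\<^sub>M distr M borel Y) (\<lambda>p. fst p \<bullet> snd p)"
      unfolding joint using int by (subst integrable_distr_eq) auto
    then show ?thesis
      using PQ.integral_fst'[of "\<lambda>p. fst p \<bullet> snd p"] by simp
  qed
  also have "\<dots> = 0"
    by (simp add: integral_distr centered)
  finally show "(\<integral>\<omega>. X \<omega> \<bullet> Y \<omega> \<partial>M) = 0" .
qed

lemma integrable_norm_of_square:
  fixes X :: "'a \<Rightarrow> 'u :: real_normed_vector"
  assumes [measurable]: "X \<in> borel_measurable M" and "integrable M (\<lambda>\<omega>. (norm (X \<omega>))\<^sup>2)"
  shows "integrable M (\<lambda>\<omega>. norm (X \<omega>))"
proof (rule Bochner_Integration.integrable_bound)
  show "integrable M (\<lambda>\<omega>. 1 + (norm (X \<omega>))\<^sup>2)"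
    using assms by simp
  have "b \<le> 1 + b\<^sup>2" for b :: real
    using zero_le_power2[of "b - 1/2"] by (simp add: power2_eq_square algebra_simps)
  then show "AE \<omega> in M. norm (norm (X \<omega>)) \<le> norm (1 + (norm (X \<omega>))\<^sup>2)"
    by simp
qed simp

text \<open>Orthogonality: the cross terms of the expanded square vanish by independence and centering.\<close>

lemma second_moment_sum_indep_centered:
  fixes X :: "'i \<Rightarrow> 'a \<Rightarrow> 'u :: {real_inner, second_countable_topology}"
  assumes "finite I" and "indep_vars (\<lambda>_. borel) X I"
    and "\<And>i. i \<in> I \<Longrightarrow> integrable M (\<lambda>\<omega>. (norm (X i \<omega>))\<^sup>2)"
    and "\<And>i h. i \<in> I \<Longrightarrow> (\<integral>\<omega>. h \<bullet> X i \<omega> \<partial>M) = 0"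
  shows "integrable M (\<lambda>\<omega>. (norm (\<Sum>i\<in>I. X i \<omega>))\<^sup>2) \<and>
    (\<integral>\<omega>. (norm (\<Sum>i\<in>I. X i \<omega>))\<^sup>2 \<partial>M) = (\<Sum>i\<in>I. \<integral>\<omega>. (norm (X i \<omega>))\<^sup>2 \<partial>M)"
  using assms
proof (induction I rule: finite_induct)
  case empty
  then show ?case
    by simp
next
  case (insert i I)
  define S where "S \<omega> = (\<Sum>j\<in>I. X j \<omega>)" for \<omega>
  have indep: "indep_var borel S borel (X i)"
    unfolding S_def using insert by (intro indep_var_sum) auto
  then have [measurable]: "S \<in> borel_measurable M" "X i \<in> borel_measurable M"
    using indep_var_rv1[OF indep] indep_var_rv2[OF indep] by auto
  have IH: "integrable M (\<lambda>\<omega>. (norm (S \<omega>))\<^sup>2)"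
    "(\<integral>\<omega>. (norm (S \<omega>))\<^sup>2 \<partial>M) = (\<Sum>j\<in>I. \<integral>\<omega>. (norm (X j \<omega>))\<^sup>2 \<partial>M)"
    unfolding S_def using insert.IH insert.prems indep_vars_subset[OF insert.prems(1), of I] by auto
  have Xi: "integrable M (\<lambda>\<omega>. (norm (X i \<omega>))\<^sup>2)"
    using insert.prems by simp
  have cross: "integrable M (\<lambda>\<omega>. S \<omega> \<bullet> X i \<omega>)" "(\<integral>\<omega>. S \<omega> \<bullet> X i \<omega> \<partial>M) = 0"
    using insert.prems IH(1) Xi
    by (auto intro!: integrable_inner_indep[OF indep] integral_inner_indep_centered[OF indep]
        integrable_norm_of_square)
  have expand: "(norm (\<Sum>j\<in>insert i I. X j \<omega>))\<^sup>2 =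
      (norm (S \<omega>))\<^sup>2 + 2 * (S \<omega> \<bullet> X i \<omega>) + (norm (X i \<omega>))\<^sup>2" for \<omega>
    using insert.hyps unfolding S_def
    by (simp add: power2_norm_eq_inner inner_add_left inner_add_right inner_commute)
  show ?case
    unfolding expand using insert.hyps IH Xi cross by simp
qed

text \<open>One summand at a time, \<open>cosh_norm_add_le\<close> bounds \<open>cosh (norm (S + X))\<close> by a product of independent
factors plus a term \<open>W(S) \<bullet> X\<close> of expectation zero, so every summand costs a factor \<open>K\<close>. Working
with the norm directly, instead of with coordinates, is what makes the estimate free of the
dimension of the space.\<close>

lemma cosh_moment_sum_indep_centered:
  fixes X :: "'i \<Rightarrow> 'a \<Rightarrow> 'u :: {real_inner, second_countable_topology}"
  assumes "finite I" and "indep_vars (\<lambda>_. borel) X I"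
    and "\<And>i. i \<in> I \<Longrightarrow> integrable M (\<lambda>\<omega>. norm (X i \<omega>))"
    and "\<And>i. i \<in> I \<Longrightarrow> integrable M (\<lambda>\<omega>. exp (norm (X i \<omega>)))"
    and "\<And>i. i \<in> I \<Longrightarrow> (\<integral>\<omega>. exp (norm (X i \<omega>)) - norm (X i \<omega>) \<partial>M) \<le> K"
    and "\<And>i h. i \<in> I \<Longrightarrow> (\<integral>\<omega>. h \<bullet> X i \<omega> \<partial>M) = 0"
  shows "integrable M (\<lambda>\<omega>. cosh (norm (\<Sum>i\<in>I. X i \<omega>))) \<and>
    (\<integral>\<omega>. cosh (norm (\<Sum>i\<in>I. X i \<omega>)) \<partial>M) \<le> K ^ card I"
  using assms
proof (induction I rule: finite_induct)
  case empty
  then show ?case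
    by (simp add: prob_space)
next
  case (insert i I)
  define S where "S \<omega> = (\<Sum>j\<in>I. X j \<omega>)" for \<omega>
  define H where "H x = exp (norm x) - norm x" for x :: 'u
  define W where "W s = (sinh (norm s) / norm s) *\<^sub>R s" for s :: 'u
  have [measurable]: "(cosh :: real \<Rightarrow> real) \<in> borel_measurable borel"
    "(sinh :: real \<Rightarrow> real) \<in> borel_measurable borel"
    by (auto intro!: borel_measurable_continuous_onI continuous_intros)
  have [measurable]: "H \<in> borel_measurable borel" "W \<in> borel_measurable borel"
    unfolding H_def W_def by measurable
  have indep: "indep_var borel S borel (X i)"
    unfolding S_def using insert by (intro indep_var_sum) auto
  then have [measurable]: "S \<in> borel_measurable M" "X i \<in> borel_measurable M"
    using indep_var_rv1[OF indep] indep_var_rv2[OF indep] by auto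
  have IH: "integrable M (\<lambda>\<omega>. cosh (norm (S \<omega>)))" "(\<integral>\<omega>. cosh (norm (S \<omega>)) \<partial>M) \<le> K ^ card I"
    unfolding S_def using insert.IH insert.prems indep_vars_subset[OF insert.prems(1), of I] by auto
  have Hi: "integrable M (\<lambda>\<omega>. H (X i \<omega>))" "(\<integral>\<omega>. H (X i \<omega>) \<partial>M) \<le> K"
    using insert.prems unfolding H_def by auto
  have H_nonneg: "0 \<le> H x" for x
    using exp_ge_add_one_self[of "norm x"] unfolding H_def by linarith
  have "indep_var borel ((\<lambda>s. cosh (norm s)) \<circ> S) borel (H \<circ> X i)"
    by (rule indep_var_compose[OF indep]) auto
  then have indep_cosh: "indep_var borel (\<lambda>\<omega>. cosh (norm (S \<omega>))) borel (\<lambda>\<omega>. H (X i \<omega>))"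
    by (simp add: comp_def)
  have "indep_var borel (W \<circ> S) borel (id \<circ> X i)"
    by (rule indep_var_compose[OF indep]) auto
  then have indep_W: "indep_var borel (\<lambda>\<omega>. W (S \<omega>)) borel (X i)"
    by (simp add: comp_def)
  have "norm (W s) \<le> cosh (norm s)" for s
    by (cases "s = 0") (auto simp: W_def sinh_le_cosh_real)
  then have W: "integrable M (\<lambda>\<omega>. norm (W (S \<omega>)))"
    by (intro Bochner_Integration.integrable_bound[OF IH(1)]) auto
  have cross: "integrable M (\<lambda>\<omega>. W (S \<omega>) \<bullet> X i \<omega>)" "(\<integral>\<omega>. W (S \<omega>) \<bullet> X i \<omega> \<partial>M) = 0"
    using insert.prems
    by (auto intro!: integrable_inner_indep[OF indep_W W] integral_inner_indep_centered[OF indep_W W])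
  have prod: "integrable M (\<lambda>\<omega>. cosh (norm (S \<omega>)) * H (X i \<omega>))"
    by (rule indep_var_integrable[OF indep_cosh IH(1) Hi(1)])
  have bound: "cosh (norm (\<Sum>j\<in>insert i I. X j \<omega>)) \<le>
      cosh (norm (S \<omega>)) * H (X i \<omega>) + W (S \<omega>) \<bullet> X i \<omega>" for \<omega>
    using insert.hyps cosh_norm_add_le[of "S \<omega>" "X i \<omega>"]
    by (simp add: S_def H_def W_def add.commute)
  have int: "integrable M (\<lambda>\<omega>. cosh (norm (\<Sum>j\<in>insert i I. X j \<omega>)))"
  proof (rule Bochner_Integration.integrable_bound)
    show "integrable M (\<lambda>\<omega>. cosh (norm (S \<omega>)) * H (X i \<omega>) + W (S \<omega>) \<bullet> X i \<omega>)"
      using prod cross by simp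
    have "(\<lambda>\<omega>. \<Sum>j\<in>insert i I. X j \<omega>) = (\<lambda>\<omega>. X i \<omega> + S \<omega>)"
      using insert.hyps by (simp add: S_def)
    then have [measurable]: "(\<lambda>\<omega>. \<Sum>j\<in>insert i I. X j \<omega>) \<in> borel_measurable M"
      by simp
    show "(\<lambda>\<omega>. cosh (norm (\<Sum>j\<in>insert i I. X j \<omega>))) \<in> borel_measurable M"
      by measurable
  qed (use bound in \<open>auto intro: order_trans[OF _ abs_ge_self]\<close>)
  have "(\<integral>\<omega>. cosh (norm (\<Sum>j\<in>insert i I. X j \<omega>)) \<partial>M) \<le>
      (\<integral>\<omega>. cosh (norm (S \<omega>)) * H (X i \<omega>) + W (S \<omega>) \<bullet> X i \<omega> \<partial>M)"
    using int prod cross bound by (intro integral_mono) auto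
  also have "\<dots> = (\<integral>\<omega>. cosh (norm (S \<omega>)) \<partial>M) * (\<integral>\<omega>. H (X i \<omega>) \<partial>M)"
    using prod cross indep_var_lebesgue_integral[OF indep_cosh IH(1) Hi(1)] by simp
  also have "\<dots> \<le> K ^ card I * K"
  proof (rule mult_mono[OF IH(2) Hi(2)])
    have "0 \<le> (\<integral>\<omega>. cosh (norm (S \<omega>)) \<partial>M)"
      by (simp add: integral_nonneg_AE)
    then show "0 \<le> K ^ card I"
      using IH(2) by linarith
    show "0 \<le> (\<integral>\<omega>. H (X i \<omega>) \<partial>M)"
      using H_nonneg by (simp add: integral_nonneg_AE)
  qed
  also have "\<dots> = K ^ card (insert i I)"
    using insert.hyps by simp
  finally show ?case
    using int by simp
qed

text \<open>With \<open>y = l\<^sup>2 * \<tau>\<^sup>2\<close>, some \<open>k \<in> {0..1}\<close> satisfies the pointwise bound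
\<open>exp (l * b) - l * b \<le> exp (3/4 * y - k + k * b\<^sup>2 / \<tau>\<^sup>2)\<close> for all \<open>b \<ge> 0\<close>: for \<open>y \<le> 16/9\<close> this is
\<open>exp_diff_le_exp_square\<close> with \<open>k = 9/16 * y\<close>, and for larger \<open>y\<close> it follows from
\<open>l * b \<le> 3/8 * y + 2/3 * b\<^sup>2 / \<tau>\<^sup>2\<close> with \<open>k = 2/3\<close>. The expectation of the right side is at most
\<open>exp (3/4 * y)\<close> by Jensen's inequality for the power \<open>k\<close>.\<close>

lemma exp_moment_of_subgaussian:
  fixes B :: "'a \<Rightarrow> real"
  assumes [measurable]: "B \<in> borel_measurable M" and B: "\<And>\<omega>. 0 \<le> B \<omega>"
    and \<tau>: "0 < \<tau>" and l: "0 \<le> l"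
    and subgauss: "(\<integral>\<^sup>+ \<omega>. ennreal (exp ((B \<omega>)\<^sup>2 / \<tau>\<^sup>2)) \<partial>M) \<le> ennreal (exp 1)"
  shows "integrable M B" "integrable M (\<lambda>\<omega>. exp (l * B \<omega>))"
    "(\<integral>\<omega>. exp (l * B \<omega>) - l * B \<omega> \<partial>M) \<le> exp (3 / 4 * l\<^sup>2 * \<tau>\<^sup>2)"
proof -
  define E where "E \<omega> = exp ((B \<omega>)\<^sup>2 / \<tau>\<^sup>2)" for \<omega>
  have [measurable]: "E \<in> borel_measurable M"
    unfolding E_def by measurable
  have nn: "(\<integral>\<^sup>+ \<omega>. ennreal (E \<omega>) \<partial>M) \<le> ennreal (exp 1)"
    using subgauss unfolding E_def .
  have E_nonneg: "0 \<le> E \<omega>" for \<omega>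
    by (simp add: E_def)
  from nn have E: "integrable M E"
    by (intro integrableI_nonneg) (auto simp: E_def le_less_trans[OF _ ennreal_less_top])
  have E_le: "(\<integral>\<omega>. E \<omega> \<partial>M) \<le> exp 1"
    using nn by (subst (asm) nn_integral_eq_integral[OF E]) (auto simp: E_nonneg)
  have "B \<omega> \<le> \<tau> * E \<omega>" for \<omega>
  proof -
    define b where "b = B \<omega> / \<tau>"
    have "b \<le> 1 + b\<^sup>2"
      using zero_le_power2[of "b - 1/2"] by (simp add: power2_eq_square algebra_simps)
    also have "\<dots> \<le> exp (b\<^sup>2)"
      by (rule exp_ge_add_one_self)
    finally show ?thesis
      using \<tau> unfolding b_def E_def by (simp add: power_divide divide_le_eq mult.commute)
  qed
  then show int_B: "integrable M B"
    using B \<tau> by (intro Bochner_Integration.integrable_bound[OF integrable_mult_right[OF E, of \<tau>]])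
      (auto intro: order_trans[OF _ abs_ge_self])
  define y where "y = l\<^sup>2 * \<tau>\<^sup>2"
  have "\<exists>k. 0 \<le> k \<and> k \<le> 1 \<and>
      (\<forall>b\<ge>0. exp (l * b) - l * b \<le> exp (3 / 4 * y - k + k * (b\<^sup>2 / \<tau>\<^sup>2)))"
  proof (cases "y \<le> 16 / 9")
    case True
    have "exp (l * b) - l * b \<le> exp (3 / 4 * y - 9 / 16 * y + 9 / 16 * y * (b\<^sup>2 / \<tau>\<^sup>2))" if "0 \<le> b" for b
    proof -
      have "exp (l * b) - l * b \<le> exp (9 / 16 * (l * b)\<^sup>2)"
        using that l by (intro exp_diff_le_exp_square) simp
      also have "9 / 16 * (l * b)\<^sup>2 = 9 / 16 * y * (b\<^sup>2 / \<tau>\<^sup>2)"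
        using \<tau> by (simp add: y_def power_mult_distrib)
      also have "exp \<dots> \<le> exp (3 / 4 * y - 9 / 16 * y + 9 / 16 * y * (b\<^sup>2 / \<tau>\<^sup>2))"
        by (simp add: y_def)
      finally show ?thesis .
    qed
    then show ?thesis
      using True by (intro exI[of _ "9 / 16 * y"]) (auto simp: y_def)
  next
    case False
    have "exp (l * b) - l * b \<le> exp (3 / 4 * y - 2 / 3 + 2 / 3 * (b\<^sup>2 / \<tau>\<^sup>2))" if "0 \<le> b" for b
    proof -
      define c where "c = b / \<tau>"
      have "l * b = (l * \<tau>) * c"
        using \<tau> by (simp add: c_def)
      also have "\<dots> \<le> 3 / 8 * (l * \<tau>)\<^sup>2 + 2 / 3 * c\<^sup>2"
        using zero_le_power2[of "3 / 4 * (l * \<tau>) - c"] by (simp add: power2_eq_square algebra_simps)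
      also have "\<dots> = 3 / 8 * y + 2 / 3 * (b\<^sup>2 / \<tau>\<^sup>2)"
        by (simp add: y_def c_def power_mult_distrib power_divide)
      finally have "l * b \<le> 3 / 4 * y - 2 / 3 + 2 / 3 * (b\<^sup>2 / \<tau>\<^sup>2)"
        using False by linarith
      then have "exp (l * b) \<le> exp (3 / 4 * y - 2 / 3 + 2 / 3 * (b\<^sup>2 / \<tau>\<^sup>2))"
        by simp
      then show ?thesis
        using that l by (smt (verit) mult_nonneg_nonneg)
    qed
    then show ?thesis
      by (intro exI[of _ "2 / 3"]) auto
  qed
  then obtain k where k: "0 \<le> k" "k \<le> 1"
    "\<And>b. 0 \<le> b \<Longrightarrow> exp (l * b) - l * b \<le> exp (3 / 4 * y - k + k * (b\<^sup>2 / \<tau>\<^sup>2))"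
    by blast
  \<comment> \<open>Convexity of the exponential function on the segment from \<open>0\<close> to \<open>B\<^sup>2 / \<tau>\<^sup>2 - 1\<close>; this is the Jensen step, in a pointwise form that is linear in \<open>E\<close>.\<close>
  have bound: "exp (l * B \<omega>) - l * B \<omega> \<le> exp (3 / 4 * y) * (1 - k + k * (E \<omega> / exp 1))" for \<omega>
  proof -
    have "exp (l * B \<omega>) - l * B \<omega> \<le> exp (3 / 4 * y + ((1 - k) * 0 + k * ((B \<omega>)\<^sup>2 / \<tau>\<^sup>2 - 1)))"
      using k(3)[OF B] by (simp add: algebra_simps)
    also have "\<dots> = exp (3 / 4 * y) * exp ((1 - k) * 0 + k * ((B \<omega>)\<^sup>2 / \<tau>\<^sup>2 - 1))"
      by (rule exp_add)
    also have "\<dots> \<le> exp (3 / 4 * y) * ((1 - k) * exp 0 + k * exp ((B \<omega>)\<^sup>2 / \<tau>\<^sup>2 - 1))"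
      using convex_onD[OF exp_convex, of k 0 "(B \<omega>)\<^sup>2 / \<tau>\<^sup>2 - 1"] k by (intro mult_left_mono) auto
    finally show ?thesis
      by (simp add: E_def exp_diff)
  qed
  have "integrable M (\<lambda>\<omega>. exp (3 / 4 * y) * (1 - k + k * (E \<omega> / exp 1)) + l * B \<omega>)"
    using E int_B by simp
  then show int_exp: "integrable M (\<lambda>\<omega>. exp (l * B \<omega>))"
    by (rule Bochner_Integration.integrable_bound)
      (use bound in \<open>auto intro!: AE_I2 order_trans[OF _ abs_ge_self] simp: diff_le_eq\<close>)
  have "(\<integral>\<omega>. exp (l * B \<omega>) - l * B \<omega> \<partial>M) \<le> (\<integral>\<omega>. exp (3 / 4 * y) * (1 - k + k * (E \<omega> / exp 1)) \<partial>M)"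
    using bound int_exp int_B E by (intro integral_mono) auto
  also have "\<dots> = exp (3 / 4 * y) * (1 - k + k * ((\<integral>\<omega>. E \<omega> \<partial>M) / exp 1))"
    using E by (simp add: prob_space)
  also have "\<dots> \<le> exp (3 / 4 * y) * (1 - k + k * 1)"
    using E_le k by (intro mult_left_mono add_left_mono) auto
  finally show "(\<integral>\<omega>. exp (l * B \<omega>) - l * B \<omega> \<partial>M) \<le> exp (3 / 4 * l\<^sup>2 * \<tau>\<^sup>2)"
    by (simp add: y_def mult.assoc)
qed

text \<open>Chernoff's method with \<open>cosh (l * norm S)\<close> in place of an exponential; the factor 2 comes from
\<open>exp x \<le> 2 * cosh x\<close>.\<close>

lemma subgaussian_tail_sum_indep_centered:
  fixes X :: "'i \<Rightarrow> 'a \<Rightarrow> 'u :: {real_inner, second_countable_topology}"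
  assumes I: "finite I" "I \<noteq> {}" and indep: "indep_vars (\<lambda>_. borel) X I"
    and centered: "\<And>i h. i \<in> I \<Longrightarrow> (\<integral>\<omega>. h \<bullet> X i \<omega> \<partial>M) = 0"
    and \<tau>: "0 < \<tau>"
    and subgauss: "\<And>i. i \<in> I \<Longrightarrow>
      (\<integral>\<^sup>+ \<omega>. ennreal (exp ((norm (X i \<omega>))\<^sup>2 / \<tau>\<^sup>2)) \<partial>M) \<le> ennreal (exp 1)"
    and r: "0 \<le> r"
  shows "prob {\<omega> \<in> space M. r \<le> norm (\<Sum>i\<in>I. X i \<omega>)} \<le> 2 * exp (- (r\<^sup>2 / (3 * \<tau>\<^sup>2 * real (card I))))"
proof -
  define n where "n = real (card I)"
  have n: "0 < n"
    using I by (simp add: n_def card_gt_0_iff)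
  \<comment> \<open>The minimizer of the exponent \<open>3/4 * n * l\<^sup>2 * \<tau>\<^sup>2 - l * r\<close>.\<close>
  define l where "l = 2 * r / (3 * \<tau>\<^sup>2 * n)"
  have l: "0 \<le> l"
    using r \<tau> n by (simp add: l_def)
  have meas [measurable]: "X i \<in> borel_measurable M" if "i \<in> I" for i
    using indep that by (auto simp: indep_vars_def)
  define S where "S \<omega> = (\<Sum>i\<in>I. X i \<omega>)" for \<omega>
  have [measurable]: "S \<in> borel_measurable M"
    unfolding S_def by measurable
  have scaled: "(\<Sum>i\<in>I. l *\<^sub>R X i \<omega>) = l *\<^sub>R S \<omega>" for \<omega>
    by (simp add: S_def scaleR_right.sum)
  have "indep_vars (\<lambda>_. borel) (\<lambda>i. (\<lambda>x. l *\<^sub>R x) \<circ> X i) I"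
    by (rule indep_vars_compose[OF indep]) simp
  moreover have "(\<integral>\<omega>. h \<bullet> (l *\<^sub>R X i \<omega>) \<partial>M) = 0" if "i \<in> I" for i h
    using centered[OF that] by simp
  moreover note exp_moment_of_subgaussian[OF _ _ \<tau> l subgauss]
  ultimately have cosh_S: "integrable M (\<lambda>\<omega>. cosh (l * norm (S \<omega>)))"
    "(\<integral>\<omega>. cosh (l * norm (S \<omega>)) \<partial>M) \<le> exp (3 / 4 * l\<^sup>2 * \<tau>\<^sup>2) ^ card I"
    using cosh_moment_sum_indep_centered[OF I(1), of "\<lambda>i \<omega>. l *\<^sub>R X i \<omega>" "exp (3 / 4 * l\<^sup>2 * \<tau>\<^sup>2)"] l meas
    by (auto simp: comp_def scaled)
  have "prob {\<omega> \<in> space M. r \<le> norm (S \<omega>)} = (\<integral>\<omega>. indicator {\<omega> \<in> space M. r \<le> norm (S \<omega>)} \<omega> \<partial>M)"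
    by simp
  also have "\<dots> \<le> (\<integral>\<omega>. 2 * exp (- (l * r)) * cosh (l * norm (S \<omega>)) \<partial>M)"
  proof (rule integral_mono)
    fix \<omega>
    have "1 \<le> 2 * exp (- (l * r)) * cosh (l * norm (S \<omega>))" if "r \<le> norm (S \<omega>)"
    proof -
      have "exp (l * r) \<le> exp (l * norm (S \<omega>))"
        using that l by (simp add: mult_left_mono)
      also have "\<dots> \<le> 2 * cosh (l * norm (S \<omega>))"
        by (simp add: cosh_def)
      finally show ?thesis
        by (simp add: exp_minus field_simps)
    qed
    then show "indicator {\<omega> \<in> space M. r \<le> norm (S \<omega>)} \<omega> \<le> 2 * exp (- (l * r)) * cosh (l * norm (S \<omega>))"
      by (auto simp: indicator_def cosh_real_nonneg)
  qed (use cosh_S in \<open>auto intro!: integrable_real_indicator simp: emeasure_eq_measure\<close>)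
  also have "\<dots> = 2 * exp (- (l * r)) * (\<integral>\<omega>. cosh (l * norm (S \<omega>)) \<partial>M)"
    using cosh_S by simp
  also have "\<dots> \<le> 2 * exp (- (l * r)) * exp (3 / 4 * l\<^sup>2 * \<tau>\<^sup>2) ^ card I"
    using cosh_S by (intro mult_left_mono) auto
  also have "\<dots> = 2 * exp (- (l * r) + n * (3 / 4 * l\<^sup>2 * \<tau>\<^sup>2))"
    by (simp only: exp_of_nat_mult exp_add n_def mult.assoc)
  also have "- (l * r) + n * (3 / 4 * l\<^sup>2 * \<tau>\<^sup>2) = - (r\<^sup>2 / (3 * \<tau>\<^sup>2 * n))"
    using n \<tau> by (simp add: l_def field_simps power2_eq_square)
  finally show ?thesis
    by (simp add: S_def n_def)
qed

end

section \<open>Sample average approximation\<close>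

theorem theorem3:
  fixes J :: "'u :: {real_inner, polish_space} \<Rightarrow> 'x :: polish_space \<Rightarrow> real"
    and \<Psi> :: "'u \<Rightarrow> ereal"
    and A :: "'a measure" and \<xi> :: "'a \<Rightarrow> 'x"
    and M :: "'w measure" and \<xi>s :: "nat \<Rightarrow> 'w \<Rightarrow> 'x"
    and ustar :: 'u and uN :: "'w \<Rightarrow> 'u"
    and N :: nat and \<alpha> \<sigma> :: real
  assumes A: "prob_space A" and xi: "\<xi> \<in> borel_measurable A"
    and M: "prob_space M" "complete_measure M"
    and indep: "prob_space.indep_vars M (\<lambda>_. borel) \<xi>s {1..}"
    and ident: "\<And>i. i \<ge> 1 \<Longrightarrow> distr M borel (\<xi>s i) = distr A borel \<xi>"
    and F_defined: "\<And>u. expectation_defined A (\<lambda>a. J u (\<xi> a))"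
    and N: "N \<ge> 1"
    and ustar: "solution (\<lambda>u. expected_cost A \<xi> J u + \<Psi> u) ustar"
    and uN: "\<And>\<omega>. \<omega> \<in> space M \<Longrightarrow>
               solution (\<lambda>u. ereal (sample_average N \<xi>s J u \<omega>) + \<Psi> u) (uN \<omega>)"
    and Psi: "ext_convex \<Psi>" "proper \<Psi>" "lower_semicontinuous \<Psi>"
    and J: "caratheodory J" "\<alpha> > 0" "\<And>x. strongly_convex \<alpha> (\<lambda>u. J u x)"
    and J_diff: "\<And>x. \<exists>V. convex V \<and> eff_dom \<Psi> \<subseteq> interior V \<and>
                       (\<forall>u\<in>V. gateaux_differentiable (\<lambda>v. ereal (J v x)) u)"
    and gradJ_meas: "partial_gradient J ustar \<in> borel_measurable borel"
    and F_diff: "gateaux_differentiable (expected_cost A \<xi> J) ustar"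
    and sigma: "\<sigma> > 0"
      "(\<integral>\<^sup>+ a. ennreal ((norm (partial_gradient J ustar (\<xi> a)
                              - gradient (expected_cost A \<xi> J) ustar))\<^sup>2) \<partial>A) \<le> ennreal (\<sigma>\<^sup>2)"
  shows "uN \<in> borel_measurable M \<and>
    (\<integral>\<^sup>+ \<omega>. ennreal ((norm (ustar - uN \<omega>))\<^sup>2) \<partial>M) \<le> ennreal (\<sigma>\<^sup>2 / (\<alpha>\<^sup>2 * real N)) \<and>
    (\<forall>\<tau>>0.
       (\<integral>\<^sup>+ a. ennreal (exp ((1 / \<tau>\<^sup>2) * (norm (partial_gradient J ustar (\<xi> a)
                              - gradient (expected_cost A \<xi> J) ustar))\<^sup>2)) \<partial>A) \<le> ennreal (exp 1)
       \<longrightarrow> (\<forall>\<epsilon>>0. \<P>(\<omega> in M. norm (ustar - uN \<omega>) \<ge> \<epsilon>)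
                    \<le> 2 * exp (- (1 / \<tau>\<^sup>2) * real N * \<epsilon>\<^sup>2 * \<alpha>\<^sup>2 / 3)))"
proof -
  interpret A: prob_space A by fact
  interpret M: prob_space M by fact
  note [measurable] = xi gradJ_meas
  define a where "a = gradient (expected_cost A \<xi> J) ustar"
  define Z where "Z x = partial_gradient J ustar x - a" for x
  define S where "S \<omega> = (\<Sum>i=1..N. Z (\<xi>s i \<omega>))" for \<omega>
  have [measurable]: "Z \<in> borel_measurable borel"
    unfolding Z_def by measurable
  have xis [measurable]: "\<xi>s i \<in> borel_measurable M" if "1 \<le> i" for i
    using indep that by (auto simp: M.indep_vars_def)

  have \<Psi>_ninfty: "\<Psi> u \<noteq> - \<infinity>" for u
    using Psi(2) by (auto simp: proper_def)
  have F_ninfty: "expected_cost A \<xi> J u \<noteq> - \<infinity>" for u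
    unfolding expected_cost_def by (rule ext_expectation_neq_MInfty[OF F_defined])
  have F': "has_gateaux_derivative (expected_cost A \<xi> J) (\<lambda>h. a \<bullet> h) ustar"
    unfolding a_def by (rule has_gateaux_derivative_gradient[OF F_diff])

  have subgrad: "J ustar x + partial_gradient J ustar x \<bullet> (v - ustar) + \<alpha> / 2 * (norm (v - ustar))\<^sup>2 \<le> J v x"
    for x v
  proof -
    have "ustar \<in> eff_dom \<Psi>"
      using solution_summands_finite(2)[OF ustar F_ninfty \<Psi>_ninfty] by (auto simp: eff_dom_def)
    then have "gateaux_differentiable (\<lambda>v. ereal (J v x)) ustar"
      using J_diff[of x] interior_subset by blast
    then show ?thesis
      unfolding partial_gradient_def
      by (intro strongly_convex_ge_gateaux_derivative[OF J(3)] has_gateaux_derivative_gradient)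
  qed

  have sc: "strongly_convex \<alpha> (\<lambda>u. sample_average N \<xi>s J u \<omega>)" for \<omega>
    using strongly_convex_average[of "{1..N}" \<alpha> "\<lambda>i u. J u (\<xi>s i \<omega>)"] N J(3)
    by (simp add: sample_average_def)

  have dist_le: "\<alpha> * norm (ustar - uN \<omega>) \<le> norm (S \<omega>) / real N" if \<omega>: "\<omega> \<in> space M" for \<omega>
  proof -
    define b where "b = (1 / real N) *\<^sub>R (\<Sum>i=1..N. partial_gradient J ustar (\<xi>s i \<omega>))"
    have "sample_average N \<xi>s J ustar \<omega> + b \<bullet> (v - ustar) + \<alpha> / 2 * (norm (v - ustar))\<^sup>2 \<le>
        sample_average N \<xi>s J v \<omega>" for v
    proof -
      have "(1 / real N) * (\<Sum>i=1..N. J ustar (\<xi>s i \<omega>) + partial_gradient J ustar (\<xi>s i \<omega>) \<bullet> (v - ustar) +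
          \<alpha> / 2 * (norm (v - ustar))\<^sup>2) \<le> (1 / real N) * (\<Sum>i=1..N. J v (\<xi>s i \<omega>))"
        by (intro mult_left_mono sum_mono subgrad) simp
      then show ?thesis
        using N by (simp add: sample_average_def b_def sum.distrib inner_sum_left distrib_left)
    qed
    then have "\<alpha> * norm (ustar - uN \<omega>) \<le> norm (b - a)"
      using \<Psi>_ninfty
      by (intro solution_distance_le_gradient_distance[OF sc Psi(1) F' ustar uN[OF \<omega>]])
    also have "b - a = (1 / real N) *\<^sub>R S \<omega>"
      using N by (simp add: b_def S_def Z_def sum_subtractf scaleR_diff_right sum_constant_scaleR)
    finally show ?thesis
      by simp
  qed

  have sq_A: "integrable A (\<lambda>x. (norm (Z (\<xi> x)))\<^sup>2)" "(\<integral>x. (norm (Z (\<xi> x)))\<^sup>2 \<partial>A) \<le> \<sigma>\<^sup>2"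
  proof -
    have le: "(\<integral>\<^sup>+ x. ennreal ((norm (Z (\<xi> x)))\<^sup>2) \<partial>A) \<le> ennreal (\<sigma>\<^sup>2)"
      using sigma(2) by (simp add: Z_def a_def)
    then show int: "integrable A (\<lambda>x. (norm (Z (\<xi> x)))\<^sup>2)"
      by (intro integrableI_nonneg) (auto simp: le_less_trans[OF _ ennreal_less_top])
    show "(\<integral>x. (norm (Z (\<xi> x)))\<^sup>2 \<partial>A) \<le> \<sigma>\<^sup>2"
      using le by (subst (asm) nn_integral_eq_integral[OF int]) auto
  qed
  have Z_A: "integrable A (\<lambda>x. h \<bullet> Z (\<xi> x))" for h
  proof (rule Bochner_Integration.integrable_bound)
    show "integrable A (\<lambda>x. norm h * norm (Z (\<xi> x)))"
      using A.integrable_norm_of_square[OF _ sq_A(1)] by simp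
  qed (auto simp: Cauchy_Schwarz_ineq2)
  have centered_A: "(\<integral>x. h \<bullet> Z (\<xi> x) \<partial>A) = 0" for h
  proof -
    have int: "integrable A (\<lambda>x. h \<bullet> partial_gradient J ustar (\<xi> x))" for h
      using Bochner_Integration.integrable_add[OF Z_A[of h] A.integrable_const[of "h \<bullet> a"]]
      by (simp add: Z_def inner_diff_right)
    have "(\<integral>x. h \<bullet> partial_gradient J ustar (\<xi> x) \<partial>A) = a \<bullet> h"
    proof (rule integral_subgradient_eq_derivative[OF F_defined F'])
      show "J ustar (\<xi> x) + partial_gradient J ustar (\<xi> x) \<bullet> (v - ustar) \<le> J v (\<xi> x)" for x v
        using subgrad[of "\<xi> x" v] J(2) by (smt (verit) half_gt_zero mult_nonneg_nonneg zero_le_power2)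
    qed (rule int)
    then show ?thesis
      using int[of h] by (simp add: Z_def inner_diff_right A.prob_space inner_commute)
  qed

  \<comment> \<open>The hypotheses concern the law of \<open>\<xi>\<close> under \<open>A\<close>, the conclusions the sample on \<open>M\<close>.\<close>
  have transfer_integrable: "integrable M (\<lambda>\<omega>. \<phi> (\<xi>s i \<omega>)) \<longleftrightarrow> integrable A (\<lambda>x. \<phi> (\<xi> x))"
    and transfer_integral: "(\<integral>\<omega>. \<phi> (\<xi>s i \<omega>) \<partial>M) = (\<integral>x. \<phi> (\<xi> x) \<partial>A)"
    if [measurable]: "\<phi> \<in> borel_measurable borel" and i: "1 \<le> i" for \<phi> :: "'x \<Rightarrow> real" and i
    using integrable_distr_eq[OF xis[OF i] that(1)] integrable_distr_eq[OF xi that(1)]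
      integral_distr[OF xis[OF i] that(1)] integral_distr[OF xi that(1)] ident[OF i] by auto
  have transfer_nn_integral: "(\<integral>\<^sup>+ \<omega>. \<phi> (\<xi>s i \<omega>) \<partial>M) = (\<integral>\<^sup>+ x. \<phi> (\<xi> x) \<partial>A)"
    if [measurable]: "\<phi> \<in> borel_measurable borel" and i: "1 \<le> i" for \<phi> :: "'x \<Rightarrow> ennreal" and i
    using nn_integral_distr[OF xis[OF i], of \<phi>] nn_integral_distr[OF xi, of \<phi>] ident[OF i] by auto

  have indep_Z: "M.indep_vars (\<lambda>_. borel) (\<lambda>i \<omega>. Z (\<xi>s i \<omega>)) {1..N}"
    by (rule M.indep_vars_compose2[OF M.indep_vars_subset[OF indep]]) auto
  have centered_M: "(\<integral>\<omega>. h \<bullet> Z (\<xi>s i \<omega>) \<partial>M) = 0" if "i \<in> {1..N}" for i h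
    using that transfer_integral[of "\<lambda>x. h \<bullet> Z x" i] centered_A by simp
  have sq_M: "integrable M (\<lambda>\<omega>. (norm (Z (\<xi>s i \<omega>)))\<^sup>2)" "(\<integral>\<omega>. (norm (Z (\<xi>s i \<omega>)))\<^sup>2 \<partial>M) \<le> \<sigma>\<^sup>2"
    if "i \<in> {1..N}" for i
    using that transfer_integrable[of "\<lambda>x. (norm (Z x))\<^sup>2" i] transfer_integral[of "\<lambda>x. (norm (Z x))\<^sup>2" i] sq_A
    by auto
  have sq_S: "integrable M (\<lambda>\<omega>. (norm (S \<omega>))\<^sup>2)"
    "(\<integral>\<omega>. (norm (S \<omega>))\<^sup>2 \<partial>M) = (\<Sum>i=1..N. \<integral>\<omega>. (norm (Z (\<xi>s i \<omega>)))\<^sup>2 \<partial>M)"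
    unfolding S_def
    using M.second_moment_sum_indep_centered[OF _ indep_Z sq_M(1) centered_M] by auto

  have meas_uN: "uN \<in> borel_measurable M"
  proof (rule solution_measurable[OF J(2) _ _ sc Psi(1,2) uN])
    have "(\<lambda>x. J v x) \<in> borel_measurable borel" for v
      using J(1) by (simp add: caratheodory_def)
    then show "sample_average N \<xi>s J v \<in> borel_measurable M" for v
      unfolding sample_average_def
      by (intro borel_measurable_times borel_measurable_sum borel_measurable_const
          measurable_compose[OF xis]) auto
    show "continuous_on UNIV (\<lambda>v. sample_average N \<xi>s J v \<omega>)" for \<omega>
      using J(1) unfolding sample_average_def caratheodory_def by (intro continuous_intros) auto
  qed

  have mean_square: "(\<integral>\<^sup>+ \<omega>. ennreal ((norm (ustar - uN \<omega>))\<^sup>2) \<partial>M) \<le> ennreal (\<sigma>\<^sup>2 / (\<alpha>\<^sup>2 * real N))"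
  proof -
    define c where "c = 1 / (\<alpha> * real N)\<^sup>2"
    have "(norm (ustar - uN \<omega>))\<^sup>2 \<le> c * (norm (S \<omega>))\<^sup>2" if "\<omega> \<in> space M" for \<omega>
    proof -
      have "norm (ustar - uN \<omega>) \<le> norm (S \<omega>) / (\<alpha> * real N)"
        using dist_le[OF that] J(2) N by (simp add: field_simps)
      then have "(norm (ustar - uN \<omega>))\<^sup>2 \<le> (norm (S \<omega>) / (\<alpha> * real N))\<^sup>2"
        by (intro power_mono) auto
      then show ?thesis
        by (simp add: c_def power_divide)
    qed
    then have "(\<integral>\<^sup>+ \<omega>. ennreal ((norm (ustar - uN \<omega>))\<^sup>2) \<partial>M) \<le> (\<integral>\<^sup>+ \<omega>. ennreal (c * (norm (S \<omega>))\<^sup>2) \<partial>M)"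
      by (intro nn_integral_mono ennreal_leI)
    also have "\<dots> = ennreal (c * (\<integral>\<omega>. (norm (S \<omega>))\<^sup>2 \<partial>M))"
      using sq_S(1) by (subst nn_integral_eq_integral) (auto simp: c_def)
    also have "\<dots> \<le> ennreal (c * (\<Sum>i=1..N. \<sigma>\<^sup>2))"
      unfolding sq_S(2) using sq_M(2) by (intro ennreal_leI mult_left_mono sum_mono) (auto simp: c_def)
    also have "c * (\<Sum>i=1..N. \<sigma>\<^sup>2) = \<sigma>\<^sup>2 / (\<alpha>\<^sup>2 * real N)"
      using J(2) N by (simp add: c_def power2_eq_square)
    finally show ?thesis .
  qed

  have tail: "\<P>(\<omega> in M. norm (ustar - uN \<omega>) \<ge> \<epsilon>) \<le> 2 * exp (- (1 / \<tau>\<^sup>2) * real N * \<epsilon>\<^sup>2 * \<alpha>\<^sup>2 / 3)"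
    if \<tau>: "0 < \<tau>" and \<epsilon>: "0 < \<epsilon>"
      and subgauss: "(\<integral>\<^sup>+ x. ennreal (exp ((1 / \<tau>\<^sup>2) * (norm (partial_gradient J ustar (\<xi> x)
                              - gradient (expected_cost A \<xi> J) ustar))\<^sup>2)) \<partial>A) \<le> ennreal (exp 1)"
    for \<tau> \<epsilon> :: real
  proof -
    define r where "r = \<alpha> * real N * \<epsilon>"
    have subgauss_M: "(\<integral>\<^sup>+ \<omega>. ennreal (exp ((norm (Z (\<xi>s i \<omega>)))\<^sup>2 / \<tau>\<^sup>2)) \<partial>M) \<le> ennreal (exp 1)"
      if "i \<in> {1..N}" for i
      using that subgauss transfer_nn_integral[of "\<lambda>x. ennreal (exp ((norm (Z x))\<^sup>2 / \<tau>\<^sup>2))" i]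
      by (simp add: Z_def a_def)
    have "\<P>(\<omega> in M. norm (ustar - uN \<omega>) \<ge> \<epsilon>) \<le> \<P>(\<omega> in M. r \<le> norm (S \<omega>))"
    proof (rule M.finite_measure_mono)
      show "{\<omega> \<in> space M. \<epsilon> \<le> norm (ustar - uN \<omega>)} \<subseteq> {\<omega> \<in> space M. r \<le> norm (S \<omega>)}"
      proof safe
        fix \<omega>
        assume "\<omega> \<in> space M" "\<epsilon> \<le> norm (ustar - uN \<omega>)"
        then have "\<alpha> * \<epsilon> \<le> norm (S \<omega>) / real N"
          using dist_le[of \<omega>] J(2) by (smt (verit) mult_left_mono)
        then show "r \<le> norm (S \<omega>)"
          using N by (simp add: r_def field_simps)
      qed
      have "S \<in> borel_measurable M"
        unfolding S_def by (intro borel_measurable_sum measurable_compose[OF xis]) auto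
      then show "{\<omega> \<in> space M. r \<le> norm (S \<omega>)} \<in> sets M"
        by measurable
    qed
    also have "\<dots> \<le> 2 * exp (- (r\<^sup>2 / (3 * \<tau>\<^sup>2 * real N)))"
      using M.subgaussian_tail_sum_indep_centered[OF _ _ indep_Z centered_M \<tau> subgauss_M, of r] N J(2) \<epsilon>
      by (simp add: S_def r_def)
    also have "- (r\<^sup>2 / (3 * \<tau>\<^sup>2 * real N)) = - (1 / \<tau>\<^sup>2) * real N * \<epsilon>\<^sup>2 * \<alpha>\<^sup>2 / 3"
      using N \<tau> by (simp add: r_def field_simps power2_eq_square)
    finally show ?thesis .
  qed

  show ?thesis
    using meas_uN mean_square tail by blast
qed

end
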